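(* Let $G=\mathrm{GIRG}(n,\beta,w_0,d)$ be a standard GIRG with $\beta>3$ and $d=o(\log n)$. Then $\omega(G)=O\big(\log n/(d+\log\log n)\big)$ asymptotically almost surely.
   Context: Fix constants $\lambda>0$, $w_0>0$, $\beta>2$. A standard GIRG $\mathrm{GIRG}(n,\beta,w_0,d)$ has $n$ vertices; each vertex $v$ independently receives a weight $w_v$ with $\Pr[w_v\le x]=1-(x/w_0)^{1-\beta}$ for $x\ge w_0$, and independently a position $\mathbf{x}_v$ uniform on the torus $\mathbb{T}^d=[0,1)^d$. The distance is $d(\mathbf{x}_u,\mathbf{x}_v)=\max_{1\le i\le d}|x_{ui}-x_{vi}|_C$ with $|a-b|_C=\min\{|a-b|,1-|a-b|\}$. Distinct $u,v$ are adjacent iff $d(\mathbf{x}_u,\mathbf{x}_v)\le \frac12\big(\frac{\lambda w_uw_v}{n}\big)^{1/d}$. The dimension $d=d(n)$ may depend on $n$. $\omega(G)$ is the size of the largest clique; "asymptotically almost surely" means with probability $1-o(1)$ as $n\to\infty$. *)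

theory Defs
  imports "HOL-Probability.Probability" "HOL-Library.Landau_Symbols"
begin

definition weight_cdf :: "real \<Rightarrow> real \<Rightarrow> real \<Rightarrow> real" where
  "weight_cdf \<beta> w0 x = (if x \<ge> w0 then 1 - (x / w0) powr (1 - \<beta>) else 0)"

definition weight_measure :: "real \<Rightarrow> real \<Rightarrow> real measure" where
  "weight_measure \<beta> w0 = interval_measure (weight_cdf \<beta> w0)"

definition torus_measure :: "nat \<Rightarrow> (nat \<Rightarrow> real) measure" where
  "torus_measure d = Pi\<^sub>M {..<d} (\<lambda>_. uniform_measure lborel {0..<1})"

text \<open>
  A sample \<open>s\<close> assigns to each vertex \<open>v < n\<close> the pair of its weight \<open>fst (s v)\<close> and its
  position \<open>snd (s v)\<close>, all of them independent.
\<close>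

definition girg_space :: "nat \<Rightarrow> real \<Rightarrow> real \<Rightarrow> nat \<Rightarrow> (nat \<Rightarrow> real \<times> (nat \<Rightarrow> real)) measure" where
  "girg_space n \<beta> w0 d = Pi\<^sub>M {..<n} (\<lambda>_. weight_measure \<beta> w0 \<Otimes>\<^sub>M torus_measure d)"

definition circle_dist :: "real \<Rightarrow> real \<Rightarrow> real" where
  "circle_dist a b = min \<bar>a - b\<bar> (1 - \<bar>a - b\<bar>)"

text \<open>Only meaningful for \<open>d \<ge> 1\<close>, since otherwise the maximum is over the empty set.\<close>

definition torus_dist :: "nat \<Rightarrow> (nat \<Rightarrow> real) \<Rightarrow> (nat \<Rightarrow> real) \<Rightarrow> real" where
  "torus_dist d x y = Max ((\<lambda>i. circle_dist (x i) (y i)) ` {..<d})"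

definition girg_edges :: "real \<Rightarrow> nat \<Rightarrow> nat \<Rightarrow> (nat \<Rightarrow> real \<times> (nat \<Rightarrow> real)) \<Rightarrow> nat set set" where
  "girg_edges lam n d s =
     {{u, v} | u v. u < n \<and> v < n \<and> u \<noteq> v \<and>
        torus_dist d (snd (s u)) (snd (s v))
          \<le> 1 / 2 * (lam * fst (s u) * fst (s v) / real n) powr (1 / real d)}"

definition is_clique :: "'a set \<Rightarrow> 'a set set \<Rightarrow> 'a set \<Rightarrow> bool" where
  "is_clique V E K \<longleftrightarrow> K \<subseteq> V \<and> (\<forall>u\<in>K. \<forall>v\<in>K. u \<noteq> v \<longrightarrow> {u, v} \<in> E)"

definition clique_number :: "'a set \<Rightarrow> 'a set set \<Rightarrow> nat" where
  "clique_number V E = Max (card ` {K. is_clique V E K})"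

lemma weight_cdf_mono:
  assumes "w0 > 0" "\<beta> > 1" "x \<le> y"
  shows "weight_cdf \<beta> w0 x \<le> weight_cdf \<beta> w0 y"
proof -
  have "(y / w0) powr (1 - \<beta>) \<le> (x / w0) powr (1 - \<beta>)" if "w0 \<le> x"
    using assms that by (intro powr_mono2') (auto simp: divide_simps)
  moreover have "(y / w0) powr (1 - \<beta>) \<le> 1" if "w0 \<le> y"
    using assms that powr_mono2'[of "1 - \<beta>" 1 "y / w0"] by (auto simp: divide_simps)
  ultimately show ?thesis
    using assms by (auto simp: weight_cdf_def)
qed

lemma weight_cdf_right_cont:
  assumes "w0 > 0" "\<beta> > 1"
  shows "continuous (at_right a) (weight_cdf \<beta> w0)"
proof (cases "a < w0")
  case True
  have "((\<lambda>_. 0 :: real) \<longlongrightarrow> 0) (at_right a)" by simp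
  moreover have "eventually (\<lambda>x. 0 = weight_cdf \<beta> w0 x) (at_right a)"
    using eventually_at_right_real[OF True] by eventually_elim (auto simp: weight_cdf_def)
  ultimately have "(weight_cdf \<beta> w0 \<longlongrightarrow> 0) (at_right a)"
    by (rule Lim_transform_eventually)
  then show ?thesis
    using True by (simp add: continuous_within weight_cdf_def)
next
  case False
  have "((\<lambda>x. 1 - (x / w0) powr (1 - \<beta>)) \<longlongrightarrow> 1 - (a / w0) powr (1 - \<beta>)) (at_right a)"
    using assms False by (intro tendsto_intros) auto
  moreover have "eventually (\<lambda>x. 1 - (x / w0) powr (1 - \<beta>) = weight_cdf \<beta> w0 x) (at_right a)"
    using eventually_at_right_less by eventually_elim (use False in \<open>auto simp: weight_cdf_def\<close>)
  ultimately have "(weight_cdf \<beta> w0 \<longlongrightarrow> 1 - (a / w0) powr (1 - \<beta>)) (at_right a)"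
    by (rule Lim_transform_eventually)
  then show ?thesis
    using False by (simp add: continuous_within weight_cdf_def)
qed

lemma weight_cdf_at_bot: "(weight_cdf \<beta> w0 \<longlongrightarrow> 0) at_bot"
proof -
  have "eventually (\<lambda>x. 0 = weight_cdf \<beta> w0 x) at_bot"
    using eventually_gt_at_bot[of w0] by (rule eventually_mono) (auto simp: weight_cdf_def)
  then show ?thesis
    by (rule Lim_transform_eventually[OF tendsto_const])
qed

lemma weight_cdf_at_top:
  assumes "w0 > 0" "\<beta> > 1"
  shows "(weight_cdf \<beta> w0 \<longlongrightarrow> 1) at_top"
proof -
  have "filterlim (\<lambda>x. x / w0) at_top at_top"
    using assms filterlim_tendsto_pos_mult_at_top[OF tendsto_const, of "1 / w0" "\<lambda>x. x" at_top]
    by (simp add: filterlim_ident)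
  then have "((\<lambda>x. (x / w0) powr (1 - \<beta>)) \<longlongrightarrow> 0) at_top"
    using assms by (intro tendsto_neg_powr) auto
  then have "((\<lambda>x. 1 - (x / w0) powr (1 - \<beta>)) \<longlongrightarrow> 1) at_top"
    using tendsto_diff[OF tendsto_const[of 1 at_top]] by fastforce
  moreover have "eventually (\<lambda>x. 1 - (x / w0) powr (1 - \<beta>) = weight_cdf \<beta> w0 x) at_top"
    using eventually_ge_at_top[of w0] by (rule eventually_mono) (auto simp: weight_cdf_def)
  ultimately show ?thesis
    by (rule Lim_transform_eventually)
qed

lemma real_distribution_weight_measure:
  assumes "w0 > 0" "\<beta> > 1"
  shows "real_distribution (weight_measure \<beta> w0)"
  unfolding weight_measure_def using assms
  by (intro real_distribution_interval_measure weight_cdf_mono weight_cdf_right_cont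
      weight_cdf_at_bot weight_cdf_at_top)

lemma cdf_weight_measure:
  assumes "w0 > 0" "\<beta> > 1"
  shows "cdf (weight_measure \<beta> w0) = weight_cdf \<beta> w0"
  unfolding weight_measure_def using assms
  by (intro cdf_interval_measure weight_cdf_mono weight_cdf_right_cont weight_cdf_at_bot)

lemma sets_weight_measure [simp, measurable_cong]: "sets (weight_measure \<beta> w0) = sets borel"
  by (simp add: weight_measure_def)

lemma sets_torus_measure [measurable_cong]: "sets (torus_measure d) = sets (Pi\<^sub>M {..<d} (\<lambda>_. borel))"
  unfolding torus_measure_def by (intro sets_PiM_cong) auto

lemma prob_space_torus_measure: "prob_space (torus_measure d)"
  unfolding torus_measure_def
  by (intro prob_space_PiM prob_space_uniform_measure) auto

lemma prob_space_girg_space: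
  assumes "w0 > 0" "\<beta> > 1"
  shows "prob_space (girg_space n \<beta> w0 d)"
proof -
  interpret W: real_distribution "weight_measure \<beta> w0"
    using assms by (rule real_distribution_weight_measure)
  interpret T: prob_space "torus_measure d" by (rule prob_space_torus_measure)
  interpret P: pair_prob_space "weight_measure \<beta> w0" "torus_measure d" ..
  show ?thesis
    unfolding girg_space_def by (intro prob_space_PiM P.prob_space_axioms)
qed

lemma clique_number_le_iff:
  assumes "finite V"
  shows "clique_number V E \<le> k \<longleftrightarrow> (\<forall>K\<in>Pow V. is_clique V E K \<longrightarrow> card K \<le> k)"
proof -
  have fin: "finite (card ` {K. is_clique V E K})"
    by (intro finite_imageI finite_subset[OF _ finite_Pow_iff[THEN iffD2, OF assms]])
      (auto simp: is_clique_def)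
  have ne: "card ` {K. is_clique V E K} \<noteq> {}"
    by (auto simp: is_clique_def)
  show ?thesis
    unfolding clique_number_def Max_le_iff[OF fin ne] by (auto simp: is_clique_def)
qed

lemma torus_dist_commute: "torus_dist d x y = torus_dist d y x"
  by (simp add: torus_dist_def circle_dist_def abs_minus_commute)

lemma girg_edges_iff:
  "{u, v} \<in> girg_edges lam n d s \<longleftrightarrow> u < n \<and> v < n \<and> u \<noteq> v \<and>
     torus_dist d (snd (s u)) (snd (s v))
       \<le> 1 / 2 * (lam * fst (s u) * fst (s v) / real n) powr (1 / real d)"
proof -
  let ?P = "\<lambda>u v. torus_dist d (snd (s u)) (snd (s v))
       \<le> 1 / 2 * (lam * fst (s u) * fst (s v) / real n) powr (1 / real d)"
  have "?P u v \<longleftrightarrow> ?P v u" for u v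
    by (subst torus_dist_commute) (simp only: mult.assoc mult.commute[of "fst (s u)"])
  then show ?thesis
    unfolding girg_edges_def mem_Collect_eq doubleton_eq_iff by metis
qed

lemma measurable_girg_edges:
  "Measurable.pred (girg_space n \<beta> w0 d) (\<lambda>s. {u, v} \<in> girg_edges lam n d s)"
proof (cases "u < n \<and> v < n")
  case True
  have [measurable]: "(\<lambda>s. s w) \<in> girg_space n \<beta> w0 d \<rightarrow>\<^sub>M weight_measure \<beta> w0 \<Otimes>\<^sub>M torus_measure d"
    if "w < n" for w
    unfolding girg_space_def using that by (intro measurable_component_singleton) auto
  have [measurable]: "(\<lambda>s. snd (s w) i) \<in> borel_measurable (girg_space n \<beta> w0 d)"
    if "w < n" "i < d" for w i
  proof -
    have [measurable]: "(\<lambda>x. x i) \<in> borel_measurable (torus_measure d)"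
      using that by (simp add: measurable_cong_sets[OF sets_torus_measure refl])
    show ?thesis using that by measurable
  qed
  have 1: "(\<lambda>s. torus_dist d (snd (s u)) (snd (s v))) \<in> borel_measurable (girg_space n \<beta> w0 d)"
    unfolding torus_dist_def circle_dist_def using True
    by (intro borel_measurable_Max borel_measurable_min borel_measurable_abs
        borel_measurable_diff borel_measurable_const) auto
  have fst_meas: "(\<lambda>s. fst (s w)) \<in> borel_measurable (girg_space n \<beta> w0 d)" if "w < n" for w
  proof -
    have "(\<lambda>s. fst (s w)) \<in> girg_space n \<beta> w0 d \<rightarrow>\<^sub>M weight_measure \<beta> w0"
      using that by measurable
    then show ?thesis by (simp cong: measurable_cong_sets)
  qed
  have 2: "(\<lambda>s. 1 / 2 * (lam * fst (s u) * fst (s v) / real n) powr (1 / real d))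
      \<in> borel_measurable (girg_space n \<beta> w0 d)"
    using True by (intro borel_measurable_times powr_real_measurable borel_measurable_divide
        borel_measurable_const fst_meas) auto
  have "Measurable.pred (girg_space n \<beta> w0 d) (\<lambda>s. torus_dist d (snd (s u)) (snd (s v))
      \<le> 1 / 2 * (lam * fst (s u) * fst (s v) / real n) powr (1 / real d))"
    using borel_measurable_le[OF 1 2] by (simp add: pred_def)
  then show ?thesis
    unfolding girg_edges_iff by (intro pred_intros_logic measurable_const) auto
next
  case False
  then have "{u, v} \<notin> girg_edges lam n d s" for s
    unfolding girg_edges_iff by blast
  then show ?thesis by simp
qed

lemma sets_clique_number_girg:
  "{s \<in> space (girg_space n \<beta> w0 d).
    real (clique_number {..<n} (girg_edges lam n d s)) \<le> r} \<in> sets (girg_space n \<beta> w0 d)"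
proof (cases "r < 0")
  case False
  have eq: "real m \<le> r \<longleftrightarrow> m \<le> nat \<lfloor>r\<rfloor>" for m
    using False by linarith
  have [measurable]: "Measurable.pred (girg_space n \<beta> w0 d) (\<lambda>s. {u, v} \<in> girg_edges lam n d s)" for u v
    by (rule measurable_girg_edges)
  have "Measurable.pred (girg_space n \<beta> w0 d)
    (\<lambda>s. \<forall>K\<in>Pow {..<n}. is_clique {..<n} (girg_edges lam n d s) K \<longrightarrow> card K \<le> nat \<lfloor>r\<rfloor>)"
    unfolding is_clique_def
    by (intro pred_intros_finite pred_intros_logic) (auto intro: finite_subset)
  then show ?thesis
    unfolding eq clique_number_le_iff[OF finite_lessThan] by (simp add: pred_def)
next
  case True
  then have "\<not> real m \<le> r" for m by (meson le_less_trans not_less of_nat_0_le_iff)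
  then show ?thesis by simp
qed

end

theory Submission
  imports Defs
begin

text \<open>
  Let \<open>v\<close> be a vertex of minimum weight \<open>w\<close> in a clique with more than \<open>2 m\<close> vertices and let
  \<open>r = (lam w\<^sup>2 / n) powr (1 / d) / 2\<close>. At least \<open>m\<close> of the other vertices are heavy (of weight above
  \<open>1.1 ^ d * w\<close>), or at least \<open>m\<close> are light. A given vertex is a heavy neighbour of \<open>v\<close> with
  probability at most \<open>const * (10/11) ^ d / n\<close>, since \<open>\<beta> > 3\<close>. In each coordinate the light
  vertices lie within \<open>1.1 r\<close> of \<open>v\<close> and within \<open>1.21 r\<close> of each other, so they all lie in one of two
  arcs of length \<open>7/4 r\<close>; for each of the \<open>2 ^ d\<close> choices of arcs, a given vertex is in the resulting
  box and at least as heavy as \<open>v\<close> with probability at most \<open>const * (7/8) ^ d / n\<close>. A union bound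
  over \<open>v\<close>, the choice of arcs and the \<open>m\<close> vertices gives the failure probability
  \<open>2 ^ (d + 1) * n * (const * (10/11) ^ d) ^ m / m!\<close>, which vanishes once
  \<open>m\<close> is a large multiple of \<open>ln n / (d + ln (ln n))\<close>. The wrap-around of the torus does not
  interfere because all weights are at most \<open>n powr \<tau>\<close> for some \<open>\<tau> < 1/2\<close> with high probability,
  and then \<open>r \<le> 1/5\<close> by \<open>d = o(ln n)\<close>.
\<close>

subsection \<open>Arcs on the circle\<close>

text \<open>The arc from \<open>x + a\<close> to \<open>x + b\<close> on the circle of reals modulo
  1, described through lifts to the line: the shift \<open>k\<close> turns wrap-around into linear
  inequalities.\<close>

definition in_arc :: "real \<Rightarrow> real \<Rightarrow> real \<Rightarrow> real \<Rightarrow> bool" where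
  "in_arc x a b y \<longleftrightarrow> (\<exists>k::int. a \<le> y - x + of_int k \<and> y - x + of_int k \<le> b)"

text \<open>Cut the lifted interval at the integers and translate each piece \<open>B k\<close> back
  to the unit interval. The translates cover the arc, and overlaps are harmless for an upper bound;
  the pieces themselves are disjoint, so their lengths add up to at most
  \<open>b - a\<close>.\<close>

lemma emeasure_in_arc_le:
  assumes "a \<le> b"
  shows "emeasure (uniform_measure lborel {0..<1}) {y. in_arc x a b y} \<le> ennreal (b - a)"
proof -
  \<comment> \<open>A finite range containing every shift that can occur; the extra 1 at either end
    is slack.\<close>
  define K where "K = {\<lfloor>x + a\<rfloor> - 1..\<lceil>x + b\<rceil> + 1}"
  define B where "B k = {x + a..x + b} \<inter> {real_of_int k..<real_of_int k + 1}" for k :: int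
  have Beq: "(\<lambda>y. of_int k + y) -` B k = {0..<1} \<inter> {x + a - of_int k..x + b - of_int k}" for k
    by (auto simp: B_def)
  have sub: "{0..<1} \<inter> {y. in_arc x a b y} \<subseteq> (\<Union>k\<in>K. (\<lambda>y. of_int k + y) -` B k)"
  proof
    fix y assume "y \<in> {0..<1} \<inter> {y. in_arc x a b y}"
    then obtain k :: int where k: "0 \<le> y" "y < 1" "a \<le> y - x + of_int k" "y - x + of_int k \<le> b"
      by (auto simp: in_arc_def)
    have "k \<in> K" unfolding K_def using k by simp linarith
    with k show "y \<in> (\<Union>k\<in>K. (\<lambda>y. of_int k + y) -` B k)"
      unfolding Beq by (intro UN_I[of k]) auto
  qed
  have meas: "in_arc x a b \<in> measurable borel (count_space UNIV)"
    unfolding in_arc_def by measurable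
  have "emeasure (uniform_measure lborel {0..<1}) {y. in_arc x a b y}
      = emeasure lborel ({0..<1} \<inter> {y. in_arc x a b y})"
    using meas by (subst emeasure_uniform_measure) (auto simp: pred_def divide_ennreal_def)
  also have "\<dots> \<le> emeasure lborel (\<Union>k\<in>K. (\<lambda>y. of_int k + y) -` B k)"
    unfolding Beq by (intro emeasure_mono sub[unfolded Beq] sets.finite_UN) (auto simp: K_def)
  also have "\<dots> \<le> (\<Sum>k\<in>K. emeasure lborel ((\<lambda>y. of_int k + y) -` B k))"
    by (intro emeasure_subadditive_finite) (auto simp: K_def Beq)
  also have "\<dots> = (\<Sum>k\<in>K. emeasure lborel (B k))"
  proof (intro sum.cong refl)
    fix k :: int
    have "emeasure lborel (B k) = emeasure (distr lborel borel ((+) (real_of_int k))) (B k)"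
      by (simp add: lborel_distr_plus)
    also have "\<dots> = emeasure lborel ((\<lambda>y. of_int k + y) -` B k)"
      by (subst emeasure_distr) (auto simp: B_def)
    finally show "emeasure lborel ((\<lambda>y. of_int k + y) -` B k) = emeasure lborel (B k)" ..
  qed
  also have "\<dots> = emeasure lborel (\<Union>k\<in>K. B k)"
  proof (rule sum_emeasure)
    show "disjoint_family_on B K"
      unfolding disjoint_family_on_def B_def by (auto; linarith)
  qed (auto simp: K_def B_def)
  also have "\<dots> \<le> emeasure lborel {x + a..x + b}"
    by (intro emeasure_mono) (auto simp: B_def)
  also have "\<dots> = ennreal (b - a)" using assms by simp
  finally show ?thesis .
qed

text \<open>Turns metric adjacency into arcs; the two wrap-around cases correspond to the shifts -1
  and 1.\<close>

lemma in_arc_of_circle_dist_le: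
  assumes "x \<in> {0..<1}" "y \<in> {0..<1}" "circle_dist x y \<le> \<rho>"
  shows "in_arc x (- \<rho>) \<rho> y"
proof -
  consider "\<bar>x - y\<bar> \<le> \<rho>" | "1 - \<bar>x - y\<bar> \<le> \<rho>" "x \<le> y" | "1 - \<bar>x - y\<bar> \<le> \<rho>" "y \<le> x"
    using assms(3) unfolding circle_dist_def by linarith
  then show ?thesis
  proof cases
    case 1 then show ?thesis unfolding in_arc_def by (intro exI[of _ 0]) auto
  next
    case 2 then show ?thesis using assms unfolding in_arc_def by (intro exI[of _ "-1"]) auto
  next
    case 3 then show ?thesis using assms unfolding in_arc_def by (intro exI[of _ 1]) auto
  qed
qed

text \<open>
  Points of pairwise distance at most \<open>1.21 r\<close> in an arc of length \<open>2.2 r\<close> avoid one of its two ends;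
  this saves a factor \<open>7/8\<close> over the length \<open>2 r\<close>.
\<close>

lemma circle_dist_gt_of_opposite_ends:
  assumes y: "y \<in> {0..<1}" "y' \<in> {0..<1}" and r: "0 \<le> r" "r \<le> 1 / 5"
    and near: "in_arc x (- (11/10 * r)) (11/10 * r) y" "in_arc x (- (11/10 * r)) (11/10 * r) y'"
    and ends: "\<not> in_arc x (- (13/20 * r)) (11/10 * r) y" "\<not> in_arc x (- (11/10 * r)) (13/20 * r) y'"
  shows "circle_dist y y' > 121/100 * r"
proof -
  obtain k :: int where k: "- (11/10 * r) \<le> y - x + k" "y - x + k \<le> 11/10 * r"
    using near by (auto simp: in_arc_def)
  obtain k' :: int where k': "- (11/10 * r) \<le> y' - x + k'" "y' - x + k' \<le> 11/10 * r"
    using near by (auto simp: in_arc_def)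
  have a: "y - x + k < - (13/20 * r)" using ends(1) k by (force simp: in_arc_def)
  have b: "y' - x + k' > 13/20 * r" using ends(2) k' by (force simp: in_arc_def)
  \<comment> \<open>The lifts differ by more than \<open>2 * 13/20 * r\<close> and at most
    \<open>2 * 11/10 * r\<close>. As \<open>r \<le> 1 / 5\<close>, this is at most 0.44, so the
    shifts differ by 0 or 1, and the way round the other side, at least 0.56, also exceeds
    \<open>121/100 * r\<close>.\<close>
  have s: "y' - y + of_int (k' - k) > 13/10 * r" "y' - y + of_int (k' - k) \<le> 11/5 * r"
    using k k' a b by auto
  have "real_of_int (k' - k) < 2" "real_of_int (k' - k) > -1" using s y r by auto
  then have "k' - k = 0 \<or> k' - k = 1" by linarith
  then have "\<bar>y - y'\<bar> = y' - y + of_int (k' - k) \<or> \<bar>y - y'\<bar> = 1 - (y' - y + of_int (k' - k))"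
    using s y r by fastforce
  then show ?thesis using s r by (auto simp: circle_dist_def)
qed

subsection \<open>Stars in product spaces\<close>

text \<open>Condition on the value \<open>x\<close> at the centre \<open>v\<close>: the coordinates
  in \<open>S\<close> are then independent, and each is related to \<open>x\<close> with probability
  at most \<open>q\<close>.\<close>

lemma (in prob_space) emeasure_PiM_star_le:
  assumes "finite I" "v \<in> I" "S \<subseteq> I - {v}" and R: "Measurable.pred (M \<Otimes>\<^sub>M M) (\<lambda>z. R (fst z) (snd z))"
    and q: "\<And>x. x \<in> space M \<Longrightarrow> emeasure M {y \<in> space M. R x y} \<le> q"
  shows "emeasure (Pi\<^sub>M I (\<lambda>_. M)) {s \<in> space (Pi\<^sub>M I (\<lambda>_. M)). \<forall>u\<in>S. R (s v) (s u)} \<le> q ^ card S"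
proof -
  interpret P: product_prob_space "\<lambda>_. M" I by standard
  define J where "J = I - {v}"
  have J: "finite J" "v \<notin> J" "I = insert v J" "S \<subseteq> J" using assms by (auto simp: J_def)
  have finS: "finite S" using J finite_subset by blast
  define E where "E = {s \<in> space (Pi\<^sub>M I (\<lambda>_. M)). \<forall>u\<in>S. R (s v) (s u)}"
  have "Measurable.pred (Pi\<^sub>M I (\<lambda>_. M)) (\<lambda>s. R (s v) (s u))" if "u \<in> S" for u
  proof -
    have "(\<lambda>s. (s v, s u)) \<in> Pi\<^sub>M I (\<lambda>_. M) \<rightarrow>\<^sub>M M \<Otimes>\<^sub>M M"
      using that assms by (intro measurable_Pair measurable_component_singleton) auto
    from measurable_compose[OF this R] show ?thesis by simp
  qed
  then have E[measurable]: "E \<in> sets (Pi\<^sub>M I (\<lambda>_. M))"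
    unfolding E_def using finS by measurable
  have "emeasure (Pi\<^sub>M I (\<lambda>_. M)) E = (\<integral>\<^sup>+s. indicator E s \<partial>Pi\<^sub>M (insert v J) (\<lambda>_. M))"
    using E J(3) by simp
  also have "\<dots> = (\<integral>\<^sup>+x. (\<integral>\<^sup>+s. indicator E (s(v := x)) \<partial>Pi\<^sub>M J (\<lambda>_. M)) \<partial>M)"
    using E J by (intro P.product_nn_integral_insert_rev) auto
  also have "\<dots> \<le> (\<integral>\<^sup>+x. q ^ card S \<partial>M)"
  proof (rule nn_integral_mono)
    fix x assume x: "x \<in> space M"
    \<comment> \<open>Coordinates outside \<open>S\<close> are unconstrained, so for fixed
      \<open>x\<close> the event lies in a box whose remaining factors are all 1.\<close>
    define F where "F u = (if u \<in> S then {y \<in> space M. R x y} else space M)" for u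
    have "Measurable.pred M (R x)"
      using measurable_compose[OF measurable_Pair1'[OF x] R] by simp
    then have F: "F u \<in> sets M" for u by (auto simp: F_def pred_def)
    have "(\<integral>\<^sup>+s. indicator E (s(v := x)) \<partial>Pi\<^sub>M J (\<lambda>_. M))
        \<le> (\<integral>\<^sup>+s. indicator (Pi\<^sub>E J F) s \<partial>Pi\<^sub>M J (\<lambda>_. M))"
    proof (rule nn_integral_mono)
      fix s assume s: "s \<in> space (Pi\<^sub>M J (\<lambda>_. M))"
      have "s \<in> Pi\<^sub>E J F" if "s(v := x) \<in> E"
      proof -
        have "R x (s u)" if "u \<in> S" for u
        proof -
          have "u \<noteq> v" using that J by auto
          then show ?thesis using \<open>s(v := x) \<in> E\<close> that by (auto simp: E_def)
        qed
        then show ?thesis using s by (auto simp: F_def space_PiM PiE_iff)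
      qed
      then show "indicator E (s(v := x)) \<le> (indicator (Pi\<^sub>E J F) s :: ennreal)"
        by (auto simp: indicator_def)
    qed
    also have "\<dots> = emeasure (Pi\<^sub>M J (\<lambda>_. M)) (Pi\<^sub>E J F)"
      using F J by (intro nn_integral_indicator sets_PiM_I_finite) auto
    also have "\<dots> = (\<Prod>u\<in>J. emeasure M (F u))"
      using F J by (intro P.emeasure_PiM) auto
    also have "\<dots> = (\<Prod>u\<in>S. emeasure M (F u))"
      using J by (intro prod.mono_neutral_right) (auto simp: F_def emeasure_space_1)
    also have "\<dots> \<le> (\<Prod>u\<in>S. q)"
      using q[OF x] by (intro prod_mono_ennreal) (auto simp: F_def)
    finally show "(\<integral>\<^sup>+s. indicator E (s(v := x)) \<partial>Pi\<^sub>M J (\<lambda>_. M)) \<le> q ^ card S" by simp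
  qed
  also have "\<dots> = q ^ card S" by (simp add: emeasure_space_1)
  finally show ?thesis by (simp add: E_def)
qed

text \<open>A centre \<open>v\<close> with \<open>m\<close> leaves, each related to the centre only.
  Relations among the leaves are deliberately absent: this keeps the leaves independent given the
  centre.\<close>

definition has_star :: "nat \<Rightarrow> nat \<Rightarrow> ('a \<Rightarrow> 'a \<Rightarrow> bool) \<Rightarrow> (nat \<Rightarrow> 'a) \<Rightarrow> bool" where
  "has_star n m R s \<longleftrightarrow> (\<exists>v<n. \<exists>S \<subseteq> {..<n} - {v}. card S = m \<and> (\<forall>u\<in>S. R (s v) (s u)))"

text \<open>Union bound over the centre and the set of leaves. The factor \<open>1 / fact m\<close>
  from counting leaf sets is what later produces \<open>ln (ln n)\<close> in the clique
  bound.\<close>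

lemma (in prob_space) measure_has_star_le:
  assumes R: "Measurable.pred (M \<Otimes>\<^sub>M M) (\<lambda>z. R (fst z) (snd z))" and "q \<ge> 0"
    and q: "\<And>x. x \<in> space M \<Longrightarrow> emeasure M {y \<in> space M. R x y} \<le> ennreal q"
  shows "{s \<in> space (Pi\<^sub>M {..<n} (\<lambda>_. M)). has_star n m R s} \<in> sets (Pi\<^sub>M {..<n} (\<lambda>_. M))" (is "?E \<in> _")
    and "measure (Pi\<^sub>M {..<n} (\<lambda>_. M)) {s \<in> space (Pi\<^sub>M {..<n} (\<lambda>_. M)). has_star n m R s}
      \<le> real n * (real n * q) ^ m / fact m"
proof -
  let ?P = "Pi\<^sub>M {..<n} (\<lambda>_. M)"
  interpret P: product_prob_space "\<lambda>_. M" "{..<n}" by standard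
  define T where "T v = {S. S \<subseteq> {..<n} - {v} \<and> card S = m}" for v
  define B where "B v S = {s \<in> space ?P. \<forall>u\<in>S. R (s v) (s u)}" for v S
  have finT: "finite (T v)" for v
    by (rule finite_subset[of _ "Pow {..<n}"]) (auto simp: T_def)
  have eq: "?E = (\<Union>v\<in>{..<n}. \<Union>S\<in>T v. B v S)"
    by (auto simp: has_star_def T_def B_def)
  have B[measurable]: "B v S \<in> sets ?P" if "v < n" "S \<in> T v" for v S
  proof -
    have fS: "finite S" using that by (auto simp: T_def intro: finite_subset)
    have "Measurable.pred ?P (\<lambda>s. R (s v) (s u))" if "u \<in> S" for u
    proof -
      have "v \<in> {..<n}" "u \<in> {..<n}" using that \<open>v < n\<close> \<open>S \<in> T v\<close> by (auto simp: T_def)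
      then have "(\<lambda>s. (s v, s u)) \<in> ?P \<rightarrow>\<^sub>M M \<Otimes>\<^sub>M M"
        by (intro measurable_Pair measurable_component_singleton) auto
      from measurable_compose[OF this R] show ?thesis by simp
    qed
    then show ?thesis unfolding B_def using fS by measurable
  qed
  show "?E \<in> sets ?P"
    unfolding eq using B finT by (intro sets.finite_UN) auto
  have "measure ?P ?E \<le> (\<Sum>v<n. measure ?P (\<Union>S\<in>T v. B v S))"
    unfolding eq using B finT by (intro P.finite_measure_subadditive_finite) (auto intro!: sets.finite_UN)
  also have "\<dots> \<le> (\<Sum>v<n. \<Sum>S\<in>T v. measure ?P (B v S))"
    using B finT by (intro sum_mono P.finite_measure_subadditive_finite) auto
  also have "\<dots> \<le> (\<Sum>v<n. \<Sum>S\<in>T v. q ^ m)"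
  proof (intro sum_mono)
    fix v S assume v: "v \<in> {..<n}" and S: "S \<in> T v"
    have "ennreal (measure ?P (B v S)) \<le> ennreal q ^ card S"
      unfolding P.emeasure_eq_measure[symmetric] B_def
      by (rule emeasure_PiM_star_le[OF _ _ _ R q]) (use v S in \<open>auto simp: T_def\<close>)
    then show "measure ?P (B v S) \<le> q ^ m"
      using S \<open>q \<ge> 0\<close> by (simp add: T_def ennreal_power)
  qed
  also have "\<dots> \<le> (\<Sum>v<n. real n ^ m / fact m * q ^ m)"
  proof (intro sum_mono)
    fix v assume v: "v \<in> {..<n}"
    have "card (T v) = (n - 1) choose m"
      unfolding T_def using v by (subst n_subsets) auto
    then have "card (T v) * fact m \<le> (n - 1) ^ m" by (simp add: binomial_fact_pow)
    also have "\<dots> \<le> n ^ m" by (intro power_mono) auto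
    finally have "real (card (T v)) * fact m \<le> real n ^ m"
      by (metis of_nat_fact of_nat_le_iff of_nat_mult of_nat_power)
    then have "real (card (T v)) \<le> real n ^ m / fact m" by (simp add: field_simps)
    then show "(\<Sum>S\<in>T v. q ^ m) \<le> real n ^ m / fact m * q ^ m"
      using mult_right_mono[of "real (card (T v))" "real n ^ m / fact m" "q ^ m"] \<open>q \<ge> 0\<close> by simp
  qed
  also have "\<dots> = real n * (real n * q) ^ m / fact m" by (simp add: power_mult_distrib)
  finally show "measure ?P ?E \<le> real n * (real n * q) ^ m / fact m" .
qed

subsection \<open>Weight tails\<close>

text \<open>Below \<open>w0\<close> the right-hand side is at least 1. That range is included
  because the bound is later applied at half of a weight, which may lie below
  \<open>w0\<close>.\<close>

lemma weight_tail_le: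
  assumes "w0 > 0" "\<beta> > 1" "x > 0"
  shows "emeasure (weight_measure \<beta> w0) {x<..} \<le> ennreal ((x / w0) powr (1 - \<beta>))"
proof -
  interpret W: real_distribution "weight_measure \<beta> w0"
    using assms by (intro real_distribution_weight_measure)
  have "UNIV - {..x} = {x<..}" by auto
  then have "W.prob {x<..} = 1 - cdf (weight_measure \<beta> w0) x"
    using W.prob_compl[of "{..x}"] by (simp add: cdf_def)
  also have "\<dots> \<le> (x / w0) powr (1 - \<beta>)"
  proof (cases "x \<ge> w0")
    case True then show ?thesis using assms by (simp add: cdf_weight_measure weight_cdf_def)
  next
    case False
    have "1 powr (1 - \<beta>) \<le> (x / w0) powr (1 - \<beta>)"
      using assms False by (intro powr_mono2') auto
    then show ?thesis using False assms by (simp add: cdf_weight_measure weight_cdf_def)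
  qed
  finally show ?thesis by (simp add: W.emeasure_eq_measure)
qed

lemma emeasure_weight_le_min:
  assumes "w0 > 0" "\<beta> > 1"
  shows "emeasure (weight_measure \<beta> w0) {..w0} = 0"
proof -
  interpret W: real_distribution "weight_measure \<beta> w0"
    using assms by (intro real_distribution_weight_measure)
  have "W.prob {..w0} = cdf (weight_measure \<beta> w0) w0" by (simp add: cdf_def)
  also have "\<dots> = 0" using assms by (simp add: cdf_weight_measure weight_cdf_def)
  finally show ?thesis by (simp add: W.emeasure_eq_measure)
qed

text \<open>Dyadic decomposition at the points \<open>x * 2 ^ i\<close>: on each level the weight is
  at most \<open>x * 2 ^ Suc i\<close>, while the tail bound shrinks by a factor of at least 4 per
  level because \<open>\<beta> > 3\<close>. This leaves a geometric series of ratio 1/2.\<close>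

lemma truncated_weight_mean_le:
  assumes "w0 > 0" "\<beta> > 3" "x > 0"
  shows "(\<integral>\<^sup>+w. ennreal w * indicator {x<..} w \<partial>weight_measure \<beta> w0)
    \<le> ennreal (4 * x * (x / w0) powr (1 - \<beta>))"
proof -
  define f where "f w i = ennreal (x * 2 ^ Suc i) * indicator {x * 2 ^ i<..} w" for w :: real and i :: nat
  have dyadic: "ennreal w * indicator {x<..} w \<le> (\<Sum>i. f w i)" for w
  proof (cases "w > x")
    case True
    \<comment> \<open>The first dyadic point not below \<open>w\<close>. It is not level 0 as
      \<open>w > x\<close>, so it has a predecessor, whose summand alone dominates
      \<open>w\<close>.\<close>
    define j where "j = (LEAST i. w \<le> x * 2 ^ i)"
    obtain i0 :: nat where "w / x < 2 ^ i0" using real_arch_pow[of 2 "w / x"] by auto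
    then have "w \<le> x * 2 ^ i0" using assms by (simp add: field_simps)
    then have j: "w \<le> x * 2 ^ j" unfolding j_def by (rule LeastI)
    have "j \<noteq> 0" using j True by (intro notI) auto
    then obtain i where i: "j = Suc i" using not0_implies_Suc by blast
    have "\<not> w \<le> x * 2 ^ i" using i not_less_Least[of i "\<lambda>i. w \<le> x * 2 ^ i"] by (auto simp: j_def)
    then have "ennreal w \<le> f w i" using j i by (auto simp: f_def intro!: ennreal_leI)
    also have "\<dots> \<le> (\<Sum>i. f w i)"
      using sum_le_suminf[of "f w" "{i}"] by simp
    finally show ?thesis using True by simp
  qed simp
  have "(\<integral>\<^sup>+w. ennreal w * indicator {x<..} w \<partial>weight_measure \<beta> w0)
      \<le> (\<integral>\<^sup>+w. (\<Sum>i. f w i) \<partial>weight_measure \<beta> w0)"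
    by (intro nn_integral_mono dyadic)
  also have "\<dots> = (\<Sum>i. \<integral>\<^sup>+w. f w i \<partial>weight_measure \<beta> w0)"
    unfolding f_def by (intro nn_integral_suminf) measurable
  also have "\<dots> = (\<Sum>i. ennreal (x * 2 ^ Suc i) * emeasure (weight_measure \<beta> w0) {x * 2 ^ i<..})"
    unfolding f_def by (intro suminf_cong nn_integral_cmult_indicator) simp
  also have "\<dots> \<le> (\<Sum>i. ennreal (2 * x * (x / w0) powr (1 - \<beta>) * (1 / 2) ^ i))"
  proof (intro suminf_le)
    fix i :: nat
    have "ennreal (x * 2 ^ Suc i) * emeasure (weight_measure \<beta> w0) {x * 2 ^ i<..}
        \<le> ennreal (x * 2 ^ Suc i) * ennreal ((x * 2 ^ i / w0) powr (1 - \<beta>))"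
      using assms by (intro mult_left_mono weight_tail_le) auto
    also have "\<dots> = ennreal (x * 2 ^ Suc i * (x * 2 ^ i / w0) powr (1 - \<beta>))"
      using assms by (simp add: ennreal_mult)
    also have "\<dots> \<le> ennreal (2 * x * (x / w0) powr (1 - \<beta>) * (1 / 2) ^ i)"
    proof (rule ennreal_leI)
      have "(x * 2 ^ i / w0) powr (1 - \<beta>) = (x / w0) powr (1 - \<beta>) * (2 ^ i) powr (1 - \<beta>)"
        using assms by (simp flip: powr_mult)
      also have "\<dots> \<le> (x / w0) powr (1 - \<beta>) * (2 ^ i) powr (-2)"
        using assms by (intro mult_left_mono powr_mono) auto
      also have "(2 ^ i :: real) powr (-2) = (1 / 2) ^ i * (1 / 2) ^ i"
        by (simp add: powr_minus powr_numeral power2_eq_square field_simps power_divide)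
      finally have "x * 2 ^ Suc i * (x * 2 ^ i / w0) powr (1 - \<beta>)
          \<le> x * 2 ^ Suc i * ((x / w0) powr (1 - \<beta>) * ((1 / 2) ^ i * (1 / 2) ^ i))"
        using assms by (intro mult_left_mono) auto
      also have "\<dots> = 2 * x * (x / w0) powr (1 - \<beta>) * (1 / 2) ^ i"
        by (simp add: field_simps power_divide)
      finally show "x * 2 ^ Suc i * (x * 2 ^ i / w0) powr (1 - \<beta>)
          \<le> 2 * x * (x / w0) powr (1 - \<beta>) * (1 / 2) ^ i" .
    qed
    finally show "ennreal (x * 2 ^ Suc i) * emeasure (weight_measure \<beta> w0) {x * 2 ^ i<..}
        \<le> ennreal (2 * x * (x / w0) powr (1 - \<beta>) * (1 / 2) ^ i)" .
  qed auto
  also have "\<dots> = ennreal (2 * x * (x / w0) powr (1 - \<beta>) * 2)"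
    using assms sums_mult[OF geometric_sums[of "1 / 2 :: real"], of "2 * x * (x / w0) powr (1 - \<beta>)"]
    by (intro suminf_ennreal_eq) auto
  finally show ?thesis by (simp add: mult_ac)
qed

subsection \<open>Light and heavy neighbours\<close>

lemma emeasure_torus_arcs_le:
  assumes "\<And>i. i < d \<Longrightarrow> a i \<le> b i"
  shows "emeasure (torus_measure d) {p \<in> space (torus_measure d). \<forall>i<d. in_arc (x i) (a i) (b i) (p i)}
    \<le> ennreal (\<Prod>i<d. b i - a i)"
proof -
  let ?U = "uniform_measure lborel {0..<1::real}"
  interpret U: prob_space ?U by (rule prob_space_uniform_measure) auto
  interpret P: product_prob_space "\<lambda>_. ?U" "{..<d}" by standard
  have eq: "{p \<in> space (torus_measure d). \<forall>i<d. in_arc (x i) (a i) (b i) (p i)}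
      = Pi\<^sub>E {..<d} (\<lambda>i. {y. in_arc (x i) (a i) (b i) y})"
    unfolding torus_measure_def space_PiM by (auto simp: PiE_def Pi_def)
  have "Measurable.pred borel (in_arc x' a' b')" for x' a' b'
    unfolding in_arc_def by measurable
  then have "emeasure (torus_measure d) {p \<in> space (torus_measure d). \<forall>i<d. in_arc (x i) (a i) (b i) (p i)}
      = (\<Prod>i<d. emeasure ?U {y. in_arc (x i) (a i) (b i) y})"
    unfolding eq unfolding torus_measure_def by (intro P.emeasure_PiM) (auto simp: pred_def)
  also have "\<dots> \<le> (\<Prod>i<d. ennreal (b i - a i))"
    using assms by (intro prod_mono_ennreal emeasure_in_arc_le) auto
  also have "\<dots> = ennreal (\<Prod>i<d. b i - a i)"
    using assms by (intro prod_ennreal) auto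
  finally show ?thesis .
qed

abbreviation vertex_measure :: "real \<Rightarrow> real \<Rightarrow> nat \<Rightarrow> (real \<times> (nat \<Rightarrow> real)) measure" where
  "vertex_measure \<beta> w0 d \<equiv> weight_measure \<beta> w0 \<Otimes>\<^sub>M torus_measure d"

definition edge_radius :: "real \<Rightarrow> nat \<Rightarrow> nat \<Rightarrow> real \<Rightarrow> real \<Rightarrow> real" where
  "edge_radius lam n d w w' = 1 / 2 * (lam * w * w' / real n) powr (1 / real d)"

text \<open>The factor \<open>(11/10) ^ d\<close> in weight corresponds to a factor 11/10 in radius.
  The condition \<open>w0 < fst x\<close> on the centre, here and for light neighbours, lets the
  probability bounds hold for every \<open>x\<close> and not just for almost every
  \<open>x\<close>.\<close>

definition heavy_neighbour ::
  "real \<Rightarrow> real \<Rightarrow> nat \<Rightarrow> nat \<Rightarrow> real \<times> (nat \<Rightarrow> real) \<Rightarrow> real \<times> (nat \<Rightarrow> real) \<Rightarrow> bool" where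
  "heavy_neighbour lam w0 n d x y \<longleftrightarrow> w0 < fst x \<and> (11/10) ^ d * fst x < fst y \<and>
     (\<forall>i<d. in_arc (snd x i) (- edge_radius lam n d (fst x) (fst y))
        (edge_radius lam n d (fst x) (fst y)) (snd y i))"

text \<open>\<open>J\<close> is the set of coordinates in which the chosen arc is the one reaching further to the right.\<close>

definition light_neighbour ::
  "real \<Rightarrow> real \<Rightarrow> nat \<Rightarrow> nat \<Rightarrow> nat set \<Rightarrow> real \<times> (nat \<Rightarrow> real) \<Rightarrow> real \<times> (nat \<Rightarrow> real) \<Rightarrow> bool" where
  "light_neighbour lam w0 n d J x y \<longleftrightarrow> w0 < fst x \<and> fst x \<le> fst y \<and>
     (\<forall>i<d. in_arc (snd x i) (- ((if i \<in> J then 13/20 else 11/10) * edge_radius lam n d (fst x) (fst x)))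
        ((if i \<in> J then 11/10 else 13/20) * edge_radius lam n d (fst x) (fst x)) (snd y i))"

section \<open>Measurability of the neighbour relations and basic facts on the radius\<close>

lemma measurable_in_arc [measurable (raw)]:
  assumes [measurable]: "f \<in> borel_measurable M" "g \<in> borel_measurable M"
    "h \<in> borel_measurable M" "k \<in> borel_measurable M"
  shows "Measurable.pred M (\<lambda>z. in_arc (f z) (g z) (h z) (k z))"
  unfolding in_arc_def by measurable

lemma borel_measurable_vertex_weight [measurable]:
  "fst \<in> borel_measurable (vertex_measure \<beta> w0 d)"
proof -
  have "fst \<in> vertex_measure \<beta> w0 d \<rightarrow>\<^sub>M weight_measure \<beta> w0" by measurable
  then show ?thesis by (simp cong: measurable_cong_sets)
qed

lemma borel_measurable_vertex_coordinate [measurable]: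
  assumes "i < d"
  shows "(\<lambda>x. snd x i) \<in> borel_measurable (vertex_measure \<beta> w0 d)"
proof -
  have [measurable]: "(\<lambda>p. p i) \<in> borel_measurable (torus_measure d)"
    using assms by (simp add: measurable_cong_sets[OF sets_torus_measure refl])
  show ?thesis by measurable
qed

lemma borel_measurable_edge_radius [measurable (raw)]:
  assumes [measurable]: "f \<in> borel_measurable M" "g \<in> borel_measurable M"
  shows "(\<lambda>z. edge_radius lam n d (f z) (g z)) \<in> borel_measurable M"
  unfolding edge_radius_def by measurable

lemma measurable_heavy_neighbour:
  "Measurable.pred (vertex_measure \<beta> w0 d \<Otimes>\<^sub>M vertex_measure \<beta> w0 d)
     (\<lambda>z. heavy_neighbour lam w0 n d (fst z) (snd z))"
  unfolding heavy_neighbour_def by measurable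

lemma measurable_light_neighbour:
  "Measurable.pred (vertex_measure \<beta> w0 d \<Otimes>\<^sub>M vertex_measure \<beta> w0 d)
     (\<lambda>z. light_neighbour lam w0 n d J (fst z) (snd z))"
  unfolding light_neighbour_def by measurable

lemma edge_radius_nonneg: "0 \<le> edge_radius lam n d w w'"
  by (simp add: edge_radius_def)

text \<open>The ball of this radius is a cube of side \<open>2 * edge_radius lam n d w w'\<close>,
  so this is its volume as long as it does not wrap around the torus.\<close>

lemma edge_radius_power:
  assumes "d \<ge> 1" "0 < lam * w * w' / real n"
  shows "(2 * edge_radius lam n d w w') ^ d = lam * w * w' / real n"
proof -
  define c where "c = lam * w * w' / real n"
  have "(2 * edge_radius lam n d w w') ^ d = (c powr (1 / real d)) powr real d"
    using assms by (subst powr_realpow) (auto simp: edge_radius_def simp flip: c_def)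
  also have "\<dots> = c"
    using assms by (simp add: powr_powr flip: c_def)
  finally show ?thesis by (simp add: c_def)
qed

lemma sets_Collect_vertex_measure:
  assumes "x \<in> space (vertex_measure \<beta> w0 d)"
    and "Measurable.pred (vertex_measure \<beta> w0 d \<Otimes>\<^sub>M vertex_measure \<beta> w0 d) (\<lambda>z. R (fst z) (snd z))"
  shows "{y \<in> space (vertex_measure \<beta> w0 d). R x y} \<in> sets (vertex_measure \<beta> w0 d)"
  using measurable_compose[OF measurable_Pair1'[OF assms(1)] assms(2)] by (simp add: pred_def)

text \<open>The box has volume at most \<open>(7/8) ^ d * (lam * w * w / n)\<close>, with
  \<open>w\<close> the weight of the centre. Being at least as heavy as the centre has probability
  of order at most \<open>w0\<^sup>2 / w\<^sup>2\<close>, which cancels the growth in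
  \<open>w\<close>.\<close>

lemma emeasure_light_neighbour_le:
  assumes "lam > 0" "w0 > 0" "\<beta> > 3" "d \<ge> 1" "n \<ge> 1"
    and x: "x \<in> space (vertex_measure \<beta> w0 d)"
  shows "emeasure (vertex_measure \<beta> w0 d)
      {y \<in> space (vertex_measure \<beta> w0 d). light_neighbour lam w0 n d J x y}
    \<le> ennreal (lam * 2 powr (\<beta> - 1) * w0\<^sup>2 * (7/8) ^ d / real n)"
proof (cases "w0 < fst x")
  case False
  then have "{y \<in> space (vertex_measure \<beta> w0 d). light_neighbour lam w0 n d J x y} = {}"
    by (auto simp: light_neighbour_def)
  then show ?thesis by (simp only: emeasure_empty zero_le)
next
  case True
  interpret W: real_distribution "weight_measure \<beta> w0"
    using assms by (intro real_distribution_weight_measure) auto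
  interpret T: prob_space "torus_measure d" by (rule prob_space_torus_measure)
  define w where "w = fst x"
  define r where "r = edge_radius lam n d w w"
  define a where "a i = - ((if i \<in> J then 13/20 else 11/10) * r)" for i
  define b where "b i = (if i \<in> J then 11/10 else 13/20) * r" for i
  have w: "w > 0" "w0 < w" using True assms by (auto simp: w_def)
  have r0: "r \<ge> 0" by (simp add: r_def edge_radius_nonneg)
  define Q where "Q = {p \<in> space (torus_measure d). \<forall>i<d. in_arc (snd x i) (a i) (b i) (p i)}"
  have [measurable]: "(\<lambda>p. p i) \<in> borel_measurable (torus_measure d)" if "i < d" for i
    using that by (simp add: measurable_cong_sets[OF sets_torus_measure refl])
  have Q[measurable]: "Q \<in> sets (torus_measure d)"
    unfolding Q_def by measurable
  \<comment> \<open>The weight condition \<open>w \<le> fst y\<close> is not strict but the tail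
    bound is; passing to \<open>w / 2\<close> costs the factor
    \<open>2 powr (\<beta> - 1)\<close>.\<close>
  have "emeasure (vertex_measure \<beta> w0 d) {y \<in> space (vertex_measure \<beta> w0 d). light_neighbour lam w0 n d J x y}
      \<le> emeasure (vertex_measure \<beta> w0 d) ({w / 2<..} \<times> Q)"
    using w by (intro emeasure_mono)
      (auto simp: light_neighbour_def w_def[symmetric] r_def[symmetric] a_def b_def Q_def space_pair_measure)
  also have "\<dots> = emeasure (weight_measure \<beta> w0) {w / 2<..} * emeasure (torus_measure d) Q"
    by (intro T.emeasure_pair_measure_Times) auto
  also have "\<dots> \<le> ennreal ((w / 2 / w0) powr (1 - \<beta>)) * ennreal (\<Prod>i<d. b i - a i)"
    unfolding Q_def using assms w r0
    by (intro mult_mono weight_tail_le emeasure_torus_arcs_le) (auto simp: a_def b_def)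
  \<comment> \<open>Either arc has length
    \<open>13/20 * r + 11/10 * r = 7/8 * (2 * r)\<close>.\<close>
  also have "(\<Prod>i<d. b i - a i) = (\<Prod>i<d. 7/8 * (2 * r))"
    by (intro prod.cong) (auto simp: a_def b_def)
  also have "\<dots> = (7/8) ^ d * (lam * w * w / real n)"
    using edge_radius_power[of d lam w w n] assms w
    by (simp only: r_def prod_constant card_lessThan power_mult_distrib[of "7/8"]) simp
  also have "ennreal ((w / 2 / w0) powr (1 - \<beta>)) * ennreal ((7/8) ^ d * (lam * w * w / real n))
      = ennreal ((w / 2 / w0) powr (1 - \<beta>) * ((7/8) ^ d * (lam * w * w / real n)))"
    using assms w by (intro ennreal_mult[symmetric]) auto
  also have "\<dots> \<le> ennreal (lam * 2 powr (\<beta> - 1) * w0\<^sup>2 * (7/8) ^ d / real n)"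
  proof (rule ennreal_leI)
    have "(w / 2 / w0) powr (1 - \<beta>) = (w / w0) powr (1 - \<beta>) * (1 / 2) powr (1 - \<beta>)"
      using assms w by (simp add: mult.commute flip: powr_mult)
    also have "(1 / 2 :: real) powr (1 - \<beta>) = 2 powr (\<beta> - 1)"
      using powr_minus_divide[of 2 "1 - \<beta>"] by (simp add: powr_divide)
    also have "(w / w0) powr (1 - \<beta>) \<le> (w / w0) powr (-2)"
      using assms w by (intro powr_mono) auto
    also have "\<dots> = w0\<^sup>2 / w\<^sup>2"
      using assms w by (simp add: powr_minus powr_numeral power_divide)
    finally have "(w / 2 / w0) powr (1 - \<beta>) \<le> w0\<^sup>2 / w\<^sup>2 * 2 powr (\<beta> - 1)" by simp
    then have "(w / 2 / w0) powr (1 - \<beta>) * ((7/8) ^ d * (lam * w * w / real n))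
        \<le> w0\<^sup>2 / w\<^sup>2 * 2 powr (\<beta> - 1) * ((7/8) ^ d * (lam * w * w / real n))"
      using assms w by (intro mult_right_mono) auto
    also have "\<dots> = lam * 2 powr (\<beta> - 1) * w0\<^sup>2 * (7/8) ^ d / real n"
      using w by (simp add: field_simps power2_eq_square)
    finally show "(w / 2 / w0) powr (1 - \<beta>) * ((7/8) ^ d * (lam * w * w / real n))
        \<le> lam * 2 powr (\<beta> - 1) * w0\<^sup>2 * (7/8) ^ d / real n" .
  qed
  finally show ?thesis .
qed

text \<open>A vertex of weight \<open>w'\<close> is close enough with probability at most
  \<open>lam * w * w' / n\<close>, so the mean of \<open>w'\<close> restricted to
  \<open>w' > t\<close> decides. It is at most \<open>4 * w0\<^sup>2 / t\<close>, and
  \<open>w / t = (10/11) ^ d\<close> is the exponential gain.\<close>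

lemma emeasure_heavy_neighbour_le:
  assumes "lam > 0" "w0 > 0" "\<beta> > 3" "d \<ge> 1" "n \<ge> 1"
    and x: "x \<in> space (vertex_measure \<beta> w0 d)"
  shows "emeasure (vertex_measure \<beta> w0 d)
      {y \<in> space (vertex_measure \<beta> w0 d). heavy_neighbour lam w0 n d x y}
    \<le> ennreal (4 * lam * w0\<^sup>2 * (10/11) ^ d / real n)"
proof (cases "w0 < fst x")
  case False
  then have "{y \<in> space (vertex_measure \<beta> w0 d). heavy_neighbour lam w0 n d x y} = {}"
    by (auto simp: heavy_neighbour_def)
  then show ?thesis by (simp only: emeasure_empty zero_le)
next
  case True
  interpret W: real_distribution "weight_measure \<beta> w0"
    using assms by (intro real_distribution_weight_measure) auto
  interpret T: prob_space "torus_measure d" by (rule prob_space_torus_measure)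
  define w where "w = fst x"
  define t where "t = (11/10) ^ d * w"
  define E where "E = {y \<in> space (vertex_measure \<beta> w0 d). heavy_neighbour lam w0 n d x y}"
  have w: "w > 0" "w0 < w" using True assms by (auto simp: w_def)
  have t: "t > 0" "t \<ge> w" using w by (auto simp: t_def)
  have E: "E \<in> sets (vertex_measure \<beta> w0 d)"
    unfolding E_def by (intro sets_Collect_vertex_measure x measurable_heavy_neighbour)
  have "emeasure (vertex_measure \<beta> w0 d) E
      = (\<integral>\<^sup>+w'. emeasure (torus_measure d) (Pair w' -` E) \<partial>weight_measure \<beta> w0)"
    using E by (rule T.emeasure_pair_measure_alt)
  also have "\<dots> \<le> (\<integral>\<^sup>+w'. ennreal (lam * w / real n) * (ennreal w' * indicator {t<..} w') \<partial>weight_measure \<beta> w0)"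
  proof (intro nn_integral_mono)
    fix w' :: real
    show "emeasure (torus_measure d) (Pair w' -` E)
      \<le> ennreal (lam * w / real n) * (ennreal w' * indicator {t<..} w')"
    proof (cases "t < w'")
      case False
      then have "Pair w' -` E = {}"
        by (auto simp: E_def heavy_neighbour_def t_def w_def)
      then show ?thesis by simp
    next
      case True
      then have w': "w' > 0" using t by simp
      define r where "r = edge_radius lam n d w w'"
      have "Pair w' -` E = {p \<in> space (torus_measure d). \<forall>i<d. in_arc (snd x i) (- r) r (p i)}"
        using True w by (auto simp: E_def heavy_neighbour_def t_def w_def r_def space_pair_measure)
      then have "emeasure (torus_measure d) (Pair w' -` E) \<le> ennreal (\<Prod>i<d. r - (- r))"
        using emeasure_torus_arcs_le[of d "\<lambda>_. - r" "\<lambda>_. r" "snd x"] edge_radius_nonneg[of lam n d w w']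
        by (simp add: r_def)
      also have "(\<Prod>i<d. r - (- r)) = (2 * r) ^ d" by simp
      also have "\<dots> = lam * w / real n * w'"
        unfolding r_def using assms w w' by (subst edge_radius_power) auto
      also have "ennreal (lam * w / real n * w') = ennreal (lam * w / real n) * ennreal w'"
        using assms w w' by (intro ennreal_mult) auto
      finally show ?thesis using True by simp
    qed
  qed
  also have "\<dots> = ennreal (lam * w / real n) * (\<integral>\<^sup>+w'. ennreal w' * indicator {t<..} w' \<partial>weight_measure \<beta> w0)"
    by (intro nn_integral_cmult) measurable
  also have "\<dots> \<le> ennreal (lam * w / real n) * ennreal (4 * t * (t / w0) powr (1 - \<beta>))"
    using assms t by (intro mult_left_mono truncated_weight_mean_le) auto
  also have "\<dots> = ennreal (lam * w / real n * (4 * t * (t / w0) powr (1 - \<beta>)))"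
    using assms w t by (intro ennreal_mult[symmetric]) auto
  also have "\<dots> \<le> ennreal (4 * lam * w0\<^sup>2 * (10/11) ^ d / real n)"
  proof (rule ennreal_leI)
    have "(t / w0) powr (1 - \<beta>) \<le> (t / w0) powr (-2)"
      using assms w t by (intro powr_mono) auto
    also have "\<dots> = w0\<^sup>2 / t\<^sup>2"
      using assms t by (simp add: powr_minus powr_numeral power_divide)
    finally have "lam * w / real n * (4 * t * (t / w0) powr (1 - \<beta>))
        \<le> lam * w / real n * (4 * t * (w0\<^sup>2 / t\<^sup>2))"
      using assms w t by (intro mult_left_mono) auto
    also have "\<dots> = 4 * lam * w0\<^sup>2 * (w / t) / real n"
      using t by (simp add: field_simps power2_eq_square)
    also have "w / t = (10/11) ^ d"
      using w by (simp add: t_def power_divide)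
    finally show "lam * w / real n * (4 * t * (t / w0) powr (1 - \<beta>))
        \<le> 4 * lam * w0\<^sup>2 * (10/11) ^ d / real n" .
  qed
  finally show ?thesis by (simp add: E_def)
qed

subsection \<open>Cliques and stars\<close>

text \<open>The radius involves a \<open>d\<close>-th root, so a factor \<open>g ^ d\<close> in the
  product of weights costs only a factor \<open>g\<close>.\<close>

lemma edge_radius_le_scaled:
  assumes "lam > 0" "d \<ge> 1" "g > 0" "0 \<le> a * b" "a * b \<le> g ^ d * (w * w)"
  shows "edge_radius lam n d a b \<le> g * edge_radius lam n d w w"
proof -
  have "lam * a * b / real n \<le> g ^ d * (lam * w * w / real n)"
    using mult_left_mono[OF assms(5), of "lam / real n"] assms(1) by (simp add: mult_ac)
  moreover have "0 \<le> lam * a * b / real n"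
    using assms by (simp add: mult.assoc)
  ultimately have "(lam * a * b / real n) powr (1 / real d)
      \<le> (g ^ d * (lam * w * w / real n)) powr (1 / real d)"
    by (intro powr_mono2) auto
  also have "\<dots> = (g ^ d) powr (1 / real d) * (lam * w * w / real n) powr (1 / real d)"
    by (rule powr_mult)
  also have "(g ^ d) powr (1 / real d) = g"
    using assms by (simp add: powr_powr flip: powr_realpow)
  finally show ?thesis by (simp add: edge_radius_def)
qed

lemma circle_dist_le_of_edge:
  assumes "{u, v} \<in> girg_edges lam n d s" "i < d"
  shows "circle_dist (snd (s u) i) (snd (s v) i) \<le> edge_radius lam n d (fst (s u)) (fst (s v))"
proof -
  have "circle_dist (snd (s u) i) (snd (s v) i) \<le> torus_dist d (snd (s u)) (snd (s v))"
    unfolding torus_dist_def using assms(2) by (intro Max_ge) auto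
  also have "\<dots> \<le> edge_radius lam n d (fst (s u)) (fst (s v))"
    using assms(1) by (simp add: girg_edges_iff edge_radius_def)
  finally show ?thesis .
qed

definition regular_vertex :: "real \<Rightarrow> real \<Rightarrow> nat \<Rightarrow> real \<times> (nat \<Rightarrow> real) \<Rightarrow> bool" where
  "regular_vertex w0 t d x \<longleftrightarrow> w0 < fst x \<and> fst x \<le> t \<and> (\<forall>i<d. snd x i \<in> {0..<1})"

text \<open>The deterministic core, with the lightest clique vertex as centre. Adjacency among the
  light members is used only to find \<open>J\<close>; once encoded there, it need not be tracked
  and a star suffices.\<close>

lemma has_star_of_clique:
  assumes "lam > 0" "w0 > 0" "d \<ge> 1" and small: "edge_radius lam n d t t \<le> 1 / 5"
    and reg: "\<And>v. v < n \<Longrightarrow> regular_vertex w0 t d (s v)"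
    and clique: "clique_number {..<n} (girg_edges lam n d s) > 2 * m"
  shows "has_star n m (heavy_neighbour lam w0 n d) s \<or>
    (\<exists>J\<in>Pow {..<d}. has_star n m (light_neighbour lam w0 n d J) s)"
proof -
  obtain K where K: "K \<subseteq> {..<n}" "card K > 2 * m"
    and edge: "\<And>u v. u \<in> K \<Longrightarrow> v \<in> K \<Longrightarrow> u \<noteq> v \<Longrightarrow> {u, v} \<in> girg_edges lam n d s"
  proof -
    obtain K where "K \<in> Pow {..<n}" "is_clique {..<n} (girg_edges lam n d s) K" "\<not> card K \<le> 2 * m"
      using clique clique_number_le_iff[of "{..<n}" "girg_edges lam n d s" "2 * m"] by auto
    then show ?thesis by (intro that[of K]) (auto simp: is_clique_def)
  qed
  have finK: "finite K" using K finite_subset by blast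
  have "K \<noteq> {}" using K by auto
  then obtain v where v: "v \<in> K" and v_min: "\<And>u. u \<in> K \<Longrightarrow> fst (s v) \<le> fst (s u)"
    using obtains_MIN[OF finK, of "\<lambda>u. fst (s u)"] Min_le[of "(\<lambda>u. fst (s u)) ` K"] finK
    by (metis finite_imageI image_eqI)
  define w where "w = fst (s v)"
  define r where "r = edge_radius lam n d w w"
  have pos: "fst (s u) > 0" "fst (s u) > w0" if "u \<in> K" for u
    using reg[of u] that K(1) \<open>w0 > 0\<close> by (auto simp: regular_vertex_def)
  have w: "w > 0" "w0 < w" "w \<le> t"
    using pos[OF v] reg[of v] v K by (auto simp: w_def regular_vertex_def)
  have r: "0 \<le> r" "r \<le> 1 / 5"
  proof -
    show "0 \<le> r" by (simp add: r_def edge_radius_nonneg)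
    have "w * w \<le> t * t" using w by (intro mult_mono) auto
    then have "r \<le> 1 * edge_radius lam n d t t"
      unfolding r_def using assms w by (intro edge_radius_le_scaled) auto
    with small show "r \<le> 1 / 5" by simp
  qed
  have unit: "snd (s u) i \<in> {0..<1}" if "u \<in> K" "i < d" for u i
    using reg[of u] that K by (auto simp: regular_vertex_def)
  define H where "H = {u \<in> K - {v}. (11/10) ^ d * w < fst (s u)}"
  define L where "L = {u \<in> K - {v}. fst (s u) \<le> (11/10) ^ d * w}"
  have fin: "finite H" "finite L" using finK by (auto simp: H_def L_def)
  have "card (K - {v}) = card H + card L"
    using fin by (subst card_Un_disjoint[symmetric]) (auto simp: H_def L_def intro!: arg_cong[of _ _ card])
  \<comment> \<open>\<open>K\<close> has at least \<open>2 * m + 1\<close> members, so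
    \<open>2 * m\<close> remain without \<open>v\<close>.\<close>
  moreover have "card (K - {v}) \<ge> 2 * m" using K v finK by simp
  ultimately consider "card H \<ge> m" | "card L \<ge> m" by linarith
  then show ?thesis
  proof cases
    case 1
    then obtain S where S: "S \<subseteq> H" "card S = m" using obtain_subset_with_card_n by metis
    have "heavy_neighbour lam w0 n d (s v) (s u)" if "u \<in> S" for u
    proof -
      have u: "u \<in> K" "u \<noteq> v" "(11/10) ^ d * w < fst (s u)" using that S by (auto simp: H_def)
      show ?thesis
        unfolding heavy_neighbour_def using u w v
        by (auto simp flip: w_def intro!: in_arc_of_circle_dist_le unit
            circle_dist_le_of_edge[of v u lam n d s, folded w_def] edge)
    qed
    then have "has_star n m (heavy_neighbour lam w0 n d) s"
      unfolding has_star_def using S v K by (intro exI[of _ v] conjI exI[of _ S]) (auto simp: H_def)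
    then show ?thesis ..
  next
    case 2
    then obtain S where S: "S \<subseteq> L" "card S = m" using obtain_subset_with_card_n by metis
    \<comment> \<open>The coordinates in which no light vertex sits at the left end of the arc
      around \<open>v\<close>. One \<open>J\<close> has to serve all leaves at once.\<close>
    define J where "J = {i. i < d \<and> (\<forall>u\<in>L. in_arc (snd (s v) i) (- (13/20 * r)) (11/10 * r) (snd (s u) i))}"
    have near: "in_arc (snd (s v) i) (- (11/10 * r)) (11/10 * r) (snd (s u) i)" if "u \<in> L" "i < d" for u i
    proof -
      have u: "u \<in> K" "u \<noteq> v" "fst (s u) \<le> (11/10) ^ d * w" using that by (auto simp: L_def)
      have "circle_dist (snd (s v) i) (snd (s u) i) \<le> edge_radius lam n d w (fst (s u))"
        using circle_dist_le_of_edge[OF edge[OF v u(1)] \<open>i < d\<close>] u by (simp add: w_def)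
      also have "\<dots> \<le> 11/10 * r"
        unfolding r_def using assms w u pos[OF u(1)] mult_left_mono[OF u(3), of w]
        by (intro edge_radius_le_scaled) (auto simp: mult_ac)
      finally show ?thesis
        using v u that by (intro in_arc_of_circle_dist_le unit) auto
    qed
    \<comment> \<open>Both weights may exceed \<open>w\<close> by a factor
      \<open>(11/10) ^ d\<close>, hence the square of 11/10 in the radius.\<close>
    have close: "circle_dist (snd (s u) i) (snd (s u') i) \<le> 121/100 * r" if "u \<in> L" "u' \<in> L" "i < d" for u u' i
    proof (cases "u = u'")
      case True
      then show ?thesis using r by (simp add: circle_dist_def)
    next
      case False
      have u: "u \<in> K" "fst (s u) \<le> (11/10) ^ d * w" "u' \<in> K" "fst (s u') \<le> (11/10) ^ d * w"
        using that by (auto simp: L_def)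
      have "fst (s u) * fst (s u') \<le> ((11/10) ^ d * w) * ((11/10) ^ d * w)"
        using u pos[OF u(1)] pos[OF u(3)] w by (intro mult_mono) auto
      also have "\<dots> = (121/100) ^ d * (w * w)"
        by (simp add: mult_ac flip: power_mult_distrib)
      finally have "edge_radius lam n d (fst (s u)) (fst (s u')) \<le> 121/100 * r"
        unfolding r_def using assms pos[OF u(1)] pos[OF u(3)] by (intro edge_radius_le_scaled) auto
      then show ?thesis
        using circle_dist_le_of_edge[OF edge[OF u(1,3) False] \<open>i < d\<close>] by linarith
    qed
    \<comment> \<open>Outside \<open>J\<close> some \<open>u'\<close> sits at the left end. A vertex
      \<open>u\<close> at the right end would be more than \<open>121/100 * r\<close> away from it,
      against \<open>close\<close>.\<close>
    have far: "in_arc (snd (s v) i) (- (11/10 * r)) (13/20 * r) (snd (s u) i)"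
      if "u \<in> L" "i < d" "i \<notin> J" for u i
    proof (rule ccontr)
      assume neg: "\<not> ?thesis"
      obtain u' where u': "u' \<in> L" "\<not> in_arc (snd (s v) i) (- (13/20 * r)) (11/10 * r) (snd (s u') i)"
        using \<open>i < d\<close> \<open>i \<notin> J\<close> by (auto simp: J_def)
      have "circle_dist (snd (s u') i) (snd (s u) i) > 121/100 * r"
        using that u' neg near r by (intro circle_dist_gt_of_opposite_ends[of _ _ r "snd (s v) i"] unit)
          (auto simp: L_def)
      with close[OF u'(1) that(1,2)] show False by simp
    qed
    have "light_neighbour lam w0 n d J (s v) (s u)" if "u \<in> S" for u
    proof -
      have u: "u \<in> L" "u \<in> K" using that S by (auto simp: L_def)
      show ?thesis
        unfolding light_neighbour_def w_def[symmetric] r_def[symmetric]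
        using u w v_min[OF u(2)] far[OF u(1)] by (auto simp: J_def w_def)
    qed
    then have "has_star n m (light_neighbour lam w0 n d J) s"
      unfolding has_star_def using S v K by (intro exI[of _ v] conjI exI[of _ S]) (auto simp: L_def)
    moreover have "J \<in> Pow {..<d}" by (auto simp: J_def)
    ultimately show ?thesis by blast
  qed
qed

section \<open>Exceptional events and the union bound\<close>

lemma prob_space_vertex_measure:
  assumes "w0 > 0" "\<beta> > 1"
  shows "prob_space (vertex_measure \<beta> w0 d)"
proof -
  interpret W: real_distribution "weight_measure \<beta> w0"
    using assms by (rule real_distribution_weight_measure)
  interpret T: prob_space "torus_measure d" by (rule prob_space_torus_measure)
  interpret P: pair_prob_space "weight_measure \<beta> w0" "torus_measure d" ..
  show ?thesis by (rule P.prob_space_axioms)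
qed

text \<open>\<open>torus_measure\<close> lives on all real-valued functions on the index set, so
  even membership of the coordinates in \<open>{0..<1}\<close> is only almost sure. So is
  \<open>w0 < fst x\<close>, as the distribution function vanishes at \<open>w0\<close>.\<close>

lemma AE_regular_vertex:
  assumes "w0 > 0" "\<beta> > 1"
  shows "AE x in vertex_measure \<beta> w0 d. fst x \<le> t \<longrightarrow> regular_vertex w0 t d x"
proof -
  interpret W: real_distribution "weight_measure \<beta> w0"
    using assms by (rule real_distribution_weight_measure)
  interpret T: prob_space "torus_measure d" by (rule prob_space_torus_measure)
  interpret P: pair_prob_space "weight_measure \<beta> w0" "torus_measure d" ..
  have W: "AE w in weight_measure \<beta> w0. w0 < w"
    by (rule AE_I[OF _ emeasure_weight_le_min[OF assms]]) auto
  have "AE p in torus_measure d. p i \<in> {0..<1}" if "i < d" for i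
    unfolding torus_measure_def using that
    by (intro AE_PiM_component prob_space_uniform_measure AE_uniform_measureI) auto
  then have T: "AE p in torus_measure d. \<forall>i\<in>{..<d}. p i \<in> {0..<1}"
    by (intro AE_finite_allI) auto
  have m: "{x \<in> space (vertex_measure \<beta> w0 d). fst x \<le> t \<longrightarrow> regular_vertex w0 t d x}
      \<in> sets (vertex_measure \<beta> w0 d)"
    unfolding regular_vertex_def by measurable
  show ?thesis
  proof (rule P.AE_pair_measure[OF m])
    show "AE w in weight_measure \<beta> w0. AE p in torus_measure d.
        fst (w, p) \<le> t \<longrightarrow> regular_vertex w0 t d (w, p)"
      using W
    proof eventually_elim
      case (elim w)
      from T show ?case by eventually_elim (use elim in \<open>auto simp: regular_vertex_def\<close>)
    qed
  qed
qed

lemma measure_heavy_weight_le: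
  assumes "w0 > 0" "\<beta> > 1" "t > 0"
  shows "{s \<in> space (girg_space n \<beta> w0 d). \<exists>v<n. fst (s v) > t} \<in> sets (girg_space n \<beta> w0 d)"
    and "measure (girg_space n \<beta> w0 d) {s \<in> space (girg_space n \<beta> w0 d). \<exists>v<n. fst (s v) > t}
      \<le> real n * (t / w0) powr (1 - \<beta>)"
proof -
  let ?G = "girg_space n \<beta> w0 d" and ?V = "vertex_measure \<beta> w0 d"
  interpret G: prob_space ?G using assms by (intro prob_space_girg_space)
  interpret V: prob_space ?V using assms by (intro prob_space_vertex_measure)
  interpret P: product_prob_space "\<lambda>_. ?V" "{..<n}" by standard
  interpret W: real_distribution "weight_measure \<beta> w0"
    using assms by (intro real_distribution_weight_measure)
  interpret T: prob_space "torus_measure d" by (rule prob_space_torus_measure)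
  define B where "B v = {s \<in> space ?G. fst (s v) > t}" for v
  have comp[measurable]: "(\<lambda>s. s v) \<in> ?G \<rightarrow>\<^sub>M ?V" if "v < n" for v
    unfolding girg_space_def using that by (intro measurable_component_singleton) auto
  have B: "B v \<in> sets ?G" if "v < n" for v
    unfolding B_def using measurable_compose[OF comp[OF that] borel_measurable_vertex_weight] by measurable
  have eq: "{s \<in> space ?G. \<exists>v<n. fst (s v) > t} = (\<Union>v<n. B v)" by (auto simp: B_def)
  show "{s \<in> space ?G. \<exists>v<n. fst (s v) > t} \<in> sets ?G"
    unfolding eq using B by (intro sets.finite_UN) auto
  have "measure ?G {s \<in> space ?G. \<exists>v<n. fst (s v) > t} \<le> (\<Sum>v<n. measure ?G (B v))"
    unfolding eq using B by (intro G.finite_measure_subadditive_finite) auto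
  also have "\<dots> \<le> (\<Sum>v<n. (t / w0) powr (1 - \<beta>))"
  proof (rule sum_mono)
    fix v assume v: "v \<in> {..<n}"
    have "B v = (\<lambda>s. s v) -` ({t<..} \<times> space (torus_measure d)) \<inter> space ?G"
      using measurable_space[OF comp, of v] v by (auto simp: B_def space_pair_measure mem_Times_iff)
    then have "emeasure ?G (B v) = emeasure (distr ?G ?V (\<lambda>s. s v)) ({t<..} \<times> space (torus_measure d))"
      using v comp by (subst emeasure_distr) auto
    also have "distr ?G ?V (\<lambda>s. s v) = ?V"
      unfolding girg_space_def using v by (intro distr_PiM_component V.prob_space_axioms) auto
    also have "emeasure ?V ({t<..} \<times> space (torus_measure d))
        = emeasure (weight_measure \<beta> w0) {t<..} * emeasure (torus_measure d) (space (torus_measure d))"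
      by (intro T.emeasure_pair_measure_Times) auto
    also have "\<dots> \<le> ennreal ((t / w0) powr (1 - \<beta>))"
      using weight_tail_le[OF assms] by (simp add: T.emeasure_space_1)
    finally show "measure ?G (B v) \<le> (t / w0) powr (1 - \<beta>)"
      by (simp add: G.emeasure_eq_measure)
  qed
  finally show "measure ?G {s \<in> space ?G. \<exists>v<n. fst (s v) > t} \<le> real n * (t / w0) powr (1 - \<beta>)"
    by simp
qed

text \<open>The sum of the constants for heavy and light neighbours; as
  \<open>7/8 \<le> 10/11\<close>, it bounds both probabilities in the common form
  \<open>star_const lam w0 \<beta> * (10/11) ^ d / n\<close>.\<close>

definition star_const :: "real \<Rightarrow> real \<Rightarrow> real \<Rightarrow> real" where
  "star_const lam w0 \<beta> = lam * (4 + 2 powr (\<beta> - 1)) * w0\<^sup>2"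

text \<open>Up to a null set, failure is covered by one event for a large weight, one for a heavy
  star and one per \<open>J\<close> for a light star. The factor \<open>2 ^ Suc d\<close> bounds the
  number \<open>1 + 2 ^ d\<close> of star events.\<close>

lemma clique_number_tail_bound:
  assumes "lam > 0" "w0 > 0" "\<beta> > 3" "d \<ge> 1" "n \<ge> 1" "t > 0"
    and small: "edge_radius lam n d t t \<le> 1 / 5" and "2 * real m \<le> b"
  shows "measure (girg_space n \<beta> w0 d)
      {s \<in> space (girg_space n \<beta> w0 d). real (clique_number {..<n} (girg_edges lam n d s)) \<le> b}
    \<ge> 1 - (real n * (t / w0) powr (1 - \<beta>)
        + 2 ^ Suc d * (real n * (star_const lam w0 \<beta> * (10/11) ^ d) ^ m / fact m))"
proof -
  let ?G = "girg_space n \<beta> w0 d" and ?V = "vertex_measure \<beta> w0 d"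
  interpret G: prob_space ?G using assms by (intro prob_space_girg_space) auto
  interpret V: prob_space ?V using assms by (intro prob_space_vertex_measure) auto
  define c where "c = star_const lam w0 \<beta>"
  define q where "q = c * (10/11) ^ d / real n"
  define e where "e = real n * (c * (10/11) ^ d) ^ m / fact m"
  have c0: "c \<ge> 0" using assms by (simp add: c_def star_const_def)
  then have q0: "q \<ge> 0" by (simp add: q_def)
  have nq: "real n * (real n * q) ^ m / fact m = e" using assms by (simp add: q_def e_def)
  define A where "A = {s \<in> space ?G. real (clique_number {..<n} (girg_edges lam n d s)) \<le> b}"
  define X where "X = {s \<in> space ?G. \<exists>v<n. fst (s v) > t}"
  define Y where "Y = {s \<in> space ?G. has_star n m (heavy_neighbour lam w0 n d) s}"
  define Z where "Z J = {s \<in> space ?G. has_star n m (light_neighbour lam w0 n d J) s}" for J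
  have A: "A \<in> sets ?G" unfolding A_def by (rule sets_clique_number_girg)
  have X: "X \<in> sets ?G" "G.prob X \<le> real n * (t / w0) powr (1 - \<beta>)"
    unfolding X_def using assms(3) by (intro measure_heavy_weight_le[OF assms(2) _ assms(6)]; linarith)+
  have Y: "Y \<in> sets ?G" "G.prob Y \<le> e"
  proof -
    have "emeasure ?V {y \<in> space ?V. heavy_neighbour lam w0 n d x y} \<le> ennreal q" if "x \<in> space ?V" for x
    proof -
      have "4 * lam * w0\<^sup>2 \<le> c" using assms by (simp add: c_def star_const_def algebra_simps)
      then have "4 * lam * w0\<^sup>2 * (10/11) ^ d / real n \<le> q"
        unfolding q_def by (intro divide_right_mono mult_right_mono) auto
      then show ?thesis
        using emeasure_heavy_neighbour_le[OF assms(1-5) that] by (meson ennreal_leI order_trans)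
    qed
    from V.measure_has_star_le[OF measurable_heavy_neighbour q0 this, of n m]
    show "Y \<in> sets ?G" "G.prob Y \<le> e" by (simp_all add: Y_def girg_space_def nq)
  qed
  have Z: "Z J \<in> sets ?G" "G.prob (Z J) \<le> e" for J
  proof -
    have "emeasure ?V {y \<in> space ?V. light_neighbour lam w0 n d J x y} \<le> ennreal q" if "x \<in> space ?V" for x
    proof -
      have "lam * 2 powr (\<beta> - 1) * w0\<^sup>2 \<le> c" using assms by (simp add: c_def star_const_def algebra_simps)
      then have "lam * 2 powr (\<beta> - 1) * w0\<^sup>2 * (7/8) ^ d / real n \<le> q"
        unfolding q_def using c0 by (intro divide_right_mono mult_mono power_mono) auto
      then show ?thesis
        using emeasure_light_neighbour_le[OF assms(1-5) that] by (meson ennreal_leI order_trans)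
    qed
    from V.measure_has_star_le[OF measurable_light_neighbour q0 this, of n m]
    show "Z J \<in> sets ?G" "G.prob (Z J) \<le> e" by (simp_all add: Z_def girg_space_def nq)
  qed
  have "AE s in ?G. fst (s v) \<le> t \<longrightarrow> regular_vertex w0 t d (s v)" if "v < n" for v
    unfolding girg_space_def using that assms
    by (intro AE_PiM_component[where P = "\<lambda>x. fst x \<le> t \<longrightarrow> regular_vertex w0 t d x"]
        V.prob_space_axioms AE_regular_vertex) auto
  then have "AE s in ?G. \<forall>v\<in>{..<n}. fst (s v) \<le> t \<longrightarrow> regular_vertex w0 t d (s v)"
    by (intro AE_finite_allI) auto
  then have "AE s in ?G. s \<in> space ?G - A \<longrightarrow> s \<in> X \<union> (Y \<union> (\<Union>J\<in>Pow {..<d}. Z J))"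
  proof (eventually_elim, intro impI)
    fix s assume reg: "\<forall>v\<in>{..<n}. fst (s v) \<le> t \<longrightarrow> regular_vertex w0 t d (s v)"
      and s: "s \<in> space ?G - A"
    show "s \<in> X \<union> (Y \<union> (\<Union>J\<in>Pow {..<d}. Z J))"
    proof (cases "s \<in> X")
      case False
      have "clique_number {..<n} (girg_edges lam n d s) > 2 * m"
        using s assms(8) by (auto simp: A_def)
      moreover have "regular_vertex w0 t d (s v)" if "v < n" for v
      proof -
        have "fst (s v) \<le> t" using False s that by (force simp: X_def)
        then show ?thesis using reg that by simp
      qed
      ultimately have "has_star n m (heavy_neighbour lam w0 n d) s \<or>
          (\<exists>J\<in>Pow {..<d}. has_star n m (light_neighbour lam w0 n d J) s)"
        by (intro has_star_of_clique[OF assms(1,2,4) small])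
      with s
      show ?thesis by (auto simp: Y_def Z_def)
    qed simp
  qed
  then have "G.prob (space ?G - A) \<le> G.prob (X \<union> (Y \<union> (\<Union>J\<in>Pow {..<d}. Z J)))"
    using A X Y Z by (intro G.finite_measure_mono_AE sets.Un sets.finite_UN) auto
  also have "\<dots> \<le> G.prob X + G.prob (Y \<union> (\<Union>J\<in>Pow {..<d}. Z J))"
    using X Y Z by (intro measure_Un_le sets.Un sets.finite_UN) auto
  also have "\<dots> \<le> G.prob X + (G.prob Y + G.prob (\<Union>J\<in>Pow {..<d}. Z J))"
    using Y Z by (intro add_left_mono measure_Un_le sets.finite_UN) auto
  also have "\<dots> \<le> real n * (t / w0) powr (1 - \<beta>) + (e + (\<Sum>J\<in>Pow {..<d}. e))"
    using X Y Z by (intro add_mono order_trans[OF G.finite_measure_subadditive_finite sum_mono]) auto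
  also have "\<dots> = real n * (t / w0) powr (1 - \<beta>) + (1 + 2 ^ d) * e"
    by (simp add: card_Pow algebra_simps)
  also have "\<dots> \<le> real n * (t / w0) powr (1 - \<beta>) + 2 ^ Suc d * e"
    using c0 by (intro add_left_mono mult_right_mono) (auto simp: e_def)
  finally show ?thesis
    using G.prob_compl[OF A] by (simp add: A_def e_def c_def)
qed

subsection \<open>Asymptotics\<close>

lemma edge_radius_le:
  assumes "d \<ge> 1" "0 \<le> lam * w * w' / real n" "lam * w * w' / real n \<le> (2 * r) ^ d" "r > 0"
  shows "edge_radius lam n d w w' \<le> r"
proof -
  define g where "g = 2 * r"
  have "(lam * w * w' / real n) powr (1 / real d) \<le> (g ^ d) powr (1 / real d)"
    using assms by (intro powr_mono2) (auto simp: g_def)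
  also have "\<dots> = g"
    using assms(1,4) by (subst powr_realpow[symmetric]) (auto simp: powr_powr g_def)
  finally show ?thesis by (simp add: edge_radius_def g_def)
qed

text \<open>A single term of the exponential series is at most the whole; this serves as a crude
  Stirling bound \<open>1 / fact m \<le> (e / m) ^ m\<close>.\<close>

lemma power_le_fact_times_exp: "real m ^ m \<le> fact m * exp (real m)"
proof -
  have "(\<Sum>k\<in>{m}. real m ^ k /\<^sub>R fact k) \<le> exp (real m)"
    using exp_converges[of "real m"]
    by (subst sums_unique[OF exp_converges]) (intro sum_le_suminf, auto simp: sums_iff)
  then show ?thesis by (simp add: field_simps)
qed

text \<open>By the crude Stirling bound the power over \<open>fact m\<close> is at most
  \<open>exp (m * E)\<close> with \<open>E \<le> - (\<delta> * D / 4)\<close>, so the lower bound on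
  \<open>m\<close> brings it down to \<open>exp (- 4 * L)\<close>. The factors \<open>exp L\<close>
  and \<open>2 ^ Suc d \<le> exp (2 * L)\<close> then leave \<open>exp (- L)\<close>.\<close>

lemma star_count_le:
  fixes c L :: real and d m :: nat
  defines "\<delta> \<equiv> ln (11/10 :: real)"
  defines "D \<equiv> real d + ln L"
  assumes "c > 0" "L \<ge> 1" "D > 0" and m: "real m \<ge> 16 * L / (\<delta> * D)"
    and D: "\<delta> * D / 4 \<ge> ln c + ln (2 / \<delta>)" and d: "(real d + 1) * ln 2 \<le> 2 * L"
  shows "2 ^ Suc d * (exp L * (c * (10/11) ^ d) ^ m / fact m) \<le> exp (- L)"
proof -
  have \<delta>: "0 < \<delta>" "\<delta> \<le> 1" using ln_le_minus_one[of "11/10"] by (auto simp: \<delta>_def)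
  have "16 * L / (\<delta> * D) > 0" using \<delta> assms by simp
  then have m0: "real m > 0" using m by linarith
  define E where "E = ln c - \<delta> * real d + 1 - ln (real m)"
  have "ln (16 * L / (\<delta> * D)) \<le> ln (real m)"
    using m m0 \<delta> assms by (subst ln_le_cancel_iff) auto
  moreover have "ln (16 * L / (\<delta> * D)) = ln (16 / \<delta>) + (ln L - ln D)"
    using \<delta> assms by (simp add: ln_div ln_mult)
  moreover have "ln (16 / \<delta>) \<ge> 0" using \<delta> by simp
  \<comment> \<open>The tangent bound is taken at \<open>\<delta> / 2 * D\<close> so that the term
    \<open>ln D\<close>, which enters through the lower bound on \<open>ln m\<close>, costs only
    half of the gain \<open>\<delta> * D\<close>; the constants take at most another quarter. The
    \<open>- 1\<close> cancels the \<open>1\<close> in \<open>E\<close>.\<close>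
  moreover have "ln (\<delta> / 2 * D) \<le> \<delta> / 2 * D - 1"
    using \<delta> assms by (intro ln_le_minus_one) auto
  moreover have "ln (\<delta> / 2 * D) = ln D - ln (2 / \<delta>)"
    using \<delta> assms by (simp add: ln_mult ln_div)
  moreover have "\<delta> * D \<le> \<delta> * real d + ln L"
    using \<delta> \<open>L \<ge> 1\<close> mult_right_mono[of \<delta> 1 "ln L"] by (simp add: D_def distrib_left)
  ultimately have "E \<le> - (\<delta> * D / 4)"
    using D unfolding E_def by linarith
  then have "real m * E \<le> real m * (- (\<delta> * D / 4))"
    using m0 by (intro mult_left_mono) auto
  also have "\<dots> \<le> 16 * L / (\<delta> * D) * (- (\<delta> * D / 4))"
    using m \<delta> assms by (intro mult_right_mono_neg) auto
  also have "\<dots> = - 4 * L" using \<delta> assms by simp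
  finally have mE: "real m * E \<le> - 4 * L" .
  have two_power: "(2 :: real) ^ Suc d = exp ((real d + 1) * ln 2)"
    using exp_of_nat_mult[of "Suc d" "ln 2 :: real"] by (simp add: add.commute)
  have "(c * (10/11) ^ d) ^ m / fact m \<le> (c * (10/11) ^ d) ^ m * (exp (real m) / real m ^ m)"
    using power_le_fact_times_exp[of m] m0 assms
    by (auto simp: field_simps intro!: mult_left_mono)
  also have "\<dots> = exp E ^ m"
  proof -
    have "exp (- (\<delta> * real d)) = (10/11) ^ d"
      using exp_of_nat_mult[of d "- \<delta>"] by (simp add: \<delta>_def exp_minus mult.commute)
    then have "exp E = c * (10/11) ^ d * exp 1 / real m"
      using m0 assms by (simp add: E_def exp_diff exp_add) (simp add: exp_minus field_simps)
    moreover have "exp (real m) = exp 1 ^ m" using exp_of_nat_mult[of m 1] by simp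
    ultimately show ?thesis by (simp add: power_mult_distrib power_divide)
  qed
  also have "\<dots> = exp (real m * E)" by (simp add: exp_of_nat_mult)
  also have "\<dots> \<le> exp (- 4 * L)" using mE by simp
  finally have "2 ^ Suc d * (exp L * ((c * (10/11) ^ d) ^ m / fact m)) \<le> 2 ^ Suc d * (exp L * exp (- 4 * L))"
    by (intro mult_left_mono) auto
  also have "\<dots> = exp ((real d + 1) * ln 2 + (L - 4 * L))"
    unfolding two_power by (simp flip: exp_add)
  also have "\<dots> \<le> exp (- L)" using d by simp
  finally show ?thesis by (simp only: times_divide_eq_right)
qed

theorem theorem17:
  fixes lam w0 \<beta> :: real and d :: "nat \<Rightarrow> nat"
  assumes "lam > 0" and "w0 > 0" and "\<beta> > 3"
    and "\<And>n. d n \<ge> 1"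
    and "(\<lambda>n. real (d n)) \<in> o(\<lambda>n. ln (real n))"
  shows "\<exists>C>0. (\<lambda>n. measure (girg_space n \<beta> w0 (d n))
           {s \<in> space (girg_space n \<beta> w0 (d n)).
              real (clique_number {..<n} (girg_edges lam n (d n) s))
                \<le> C * (ln (real n) / (real (d n) + ln (ln (real n))))}) \<longlonglongrightarrow> 1"
proof -
  define \<delta> :: real where "\<delta> = ln (11/10)"
  \<comment> \<open>With this value \<open>m n\<close> is twice the bound that
    \<open>star_count_le\<close> requires, rounded down. As that bound is eventually at least 1,
    rounding leaves enough.\<close>
  define C where "C = 64 / \<delta>"
  \<comment> \<open>The midpoint between \<open>1 / (\<beta> - 1)\<close> and \<open>1 / 2\<close>,
    which are in this order as \<open>\<beta> > 3\<close>. Lying above the former makes a weight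
    beyond \<open>t n\<close> unlikely, lying below the latter makes \<open>t n * t n / n\<close>
    vanish.\<close>
  define \<tau> where "\<tau> = (1 / (\<beta> - 1) + 1 / 2) / 2"
  define c where "c = star_const lam w0 \<beta>"
  define L where "L n = ln (real n)" for n
  define D where "D n = real (d n) + ln (L n)" for n
  define m where "m n = nat \<lfloor>C * (L n / D n) / 2\<rfloor>" for n
  define t where "t n = real n powr \<tau>" for n
  let ?p = "\<lambda>n. measure (girg_space n \<beta> w0 (d n))
           {s \<in> space (girg_space n \<beta> w0 (d n)).
              real (clique_number {..<n} (girg_edges lam n (d n) s)) \<le> C * (L n / D n)}"
  have \<delta>: "0 < \<delta>" "\<delta> \<le> 1" using ln_le_minus_one[of "11/10"] by (auto simp: \<delta>_def)
  have C: "C > 0" using \<delta> by (simp add: C_def)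
  have c: "c > 0" using assms by (simp add: c_def star_const_def add_pos_pos)
  have \<tau>_eq: "\<tau> * (1 - \<beta>) = - (1 / 2) - (\<beta> - 1) / 4"
    using assms(3) by (simp add: \<tau>_def field_simps)
  have \<tau>: "1 + \<tau> * (1 - \<beta>) < 0" unfolding \<tau>_eq using assms(3) by simp
  have \<tau>_less: "\<tau> < 1 / 2" using assms(3) by (simp add: \<tau>_def field_simps)
  have L_top: "filterlim L at_top sequentially"
    unfolding L_def by (rule filterlim_compose[OF ln_at_top filterlim_real_sequentially])
  have lnL_top: "filterlim (\<lambda>n. ln (L n)) at_top sequentially"
    by (rule filterlim_compose[OF ln_at_top L_top])
  have d_small: "eventually (\<lambda>n. real (d n) \<le> \<epsilon> * L n) sequentially" if "\<epsilon> > 0" for \<epsilon>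
    using landau_o.smallD[OF assms(5) that] eventually_ge_at_top[of 1]
    by eventually_elim (simp add: L_def)
  have lnL_small: "eventually (\<lambda>n. ln (L n) \<le> 1 / 2 * L n) sequentially"
  proof -
    have "((\<lambda>x::real. ln x / x) \<longlongrightarrow> 0) at_top" by (rule ln_x_over_x_tendsto_0)
    then have "((\<lambda>n. ln (L n) / L n) \<longlonglongrightarrow> 0)" by (rule filterlim_compose[OF _ L_top])
    then have "eventually (\<lambda>n. ln (L n) / L n < 1 / 2) sequentially"
      by (rule order_tendstoD) simp
    moreover have "eventually (\<lambda>n. L n > 0) sequentially"
      using L_top by (auto simp: filterlim_at_top_dense)
    ultimately show ?thesis by eventually_elim (simp add: field_simps)
  qed
  \<comment> \<open>If \<open>d n\<close> is at most this multiple of \<open>L n\<close>, then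
    \<open>(5/2) ^ d n\<close> is at most \<open>n powr ((1 - 2 * \<tau>) / 2)\<close>. The other
    half of the exponent absorbs \<open>lam\<close>, and the radius is at most 1/5.\<close>
  have \<kappa>: "(1 - 2 * \<tau>) / (2 * ln (5 / 2)) > 0" using \<tau>_less by simp
  \<comment> \<open>\<open>D n \<ge> K\<close> is the condition of \<open>star_count_le\<close> on
    the additive constants; it holds eventually because \<open>ln (L n)\<close> tends to
    infinity.\<close>
  define K where "K = 4 / \<delta> * (ln c + ln (2 / \<delta>))"
  have lower: "eventually (\<lambda>n. 1 - (real n * (t n / w0) powr (1 - \<beta>) + exp (- L n)) \<le> ?p n) sequentially"
    using eventually_ge_at_top[of 1]
      filterlim_at_top[THEN iffD1, OF L_top, rule_format, of 1]
      filterlim_at_top[THEN iffD1, OF L_top, rule_format, of "2 * ln lam / (1 - 2 * \<tau>)"]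
      filterlim_at_top[THEN iffD1, OF lnL_top, rule_format, of K]
      filterlim_at_top[THEN iffD1, OF lnL_top, rule_format, of 1]
      lnL_small d_small[OF half_gt_zero[OF zero_less_one]] d_small[OF \<kappa>]
  proof eventually_elim
    case (elim n)
    have n: "real n > 0" "exp (L n) = real n" using elim by (auto simp: L_def)
    \<comment> \<open>Both \<open>d n\<close> and \<open>ln (L n)\<close> are at most
      \<open>L n / 2\<close> here, hence \<open>D n \<le> L n\<close>.\<close>
    have D: "D n > 0" "D n \<ge> K" "D n \<le> L n" using elim by (auto simp: D_def)
    have "1 \<le> L n / D n" using D by simp
    then have R: "16 * L n / (\<delta> * D n) \<ge> 1"
      using \<delta> mult_mono[of 1 "16 / \<delta>" 1 "L n / D n"] by simp
    have C_R: "C * (L n / D n) / 2 = 2 * (16 * L n / (\<delta> * D n))"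
      using \<delta> D by (simp add: C_def)
    have m_ge: "real (m n) \<ge> 16 * L n / (\<delta> * D n)"
      unfolding m_def C_R using R by linarith
    have m_le: "2 * real (m n) \<le> C * (L n / D n)"
    proof -
      have "C * (L n / D n) / 2 \<ge> 0" using R C_R by linarith
      then have "real (m n) \<le> C * (L n / D n) / 2" unfolding m_def by (rule of_nat_floor)
      then show ?thesis by (simp add: field_simps)
    qed
    have count: "2 ^ Suc (d n) * (exp (L n) * (c * (10/11) ^ d n) ^ m n / fact (m n)) \<le> exp (- L n)"
    proof (rule star_count_le)
      show "ln c + ln (2 / ln (11 / 10)) \<le> ln (11 / 10) * (real (d n) + ln (L n)) / 4"
        using D(2) \<delta> unfolding K_def by (simp add: field_simps flip: \<delta>_def D_def)
      have "(real (d n) + 1) * ln 2 \<le> (real (d n) + 1) * 1"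
        using ln_2_less_1 by (intro mult_left_mono) auto
      also have "\<dots> \<le> 2 * L n" using elim by simp
      finally show "(real (d n) + 1) * ln 2 \<le> 2 * L n" .
    qed (use c elim D m_ge in \<open>simp_all flip: \<delta>_def add: D_def\<close>)
    have tt: "lam * t n * t n / real n = lam * real n powr (2 * \<tau> - 1)"
      using n by (simp add: t_def powr_diff flip: powr_add)
    have "edge_radius lam n (d n) (t n) (t n) \<le> 1 / 5"
    proof (rule edge_radius_le)
      have "real (d n) * ln (5 / 2) \<le> (1 - 2 * \<tau>) / 2 * L n"
        using elim(8) by (simp add: field_simps)
      moreover have "ln lam \<le> (1 - 2 * \<tau>) / 2 * L n"
        using elim(3) \<tau>_less by (simp add: field_simps)
      ultimately have "ln lam + (2 * \<tau> - 1) * L n \<le> - (real (d n) * ln (5 / 2))"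
        by (simp add: field_simps)
      then have "exp (ln lam + (2 * \<tau> - 1) * L n) \<le> exp (real (d n) * - ln (5 / 2))" by simp
      also have "exp (real (d n) * - ln (5 / 2)) = (2 * (1 / 5)) ^ d n"
        by (simp only: exp_of_nat_mult) (simp add: exp_minus)
      also have "exp (ln lam + (2 * \<tau> - 1) * L n) = lam * t n * t n / real n"
        unfolding tt using assms n by (simp add: exp_add powr_def L_def)
      finally show "lam * t n * t n / real n \<le> (2 * (1 / 5)) ^ d n" .
    qed (use assms in \<open>auto simp: t_def\<close>)
    then have "1 - (real n * (t n / w0) powr (1 - \<beta>)
        + 2 ^ Suc (d n) * (real n * (c * (10/11) ^ d n) ^ m n / fact (m n))) \<le> ?p n"
      unfolding c_def using assms n m_le by (intro clique_number_tail_bound) (auto simp: t_def)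
    then show ?case using count unfolding n(2) by linarith
  qed
  have lower_lim: "(\<lambda>n. 1 - (real n * (t n / w0) powr (1 - \<beta>) + exp (- L n))) \<longlonglongrightarrow> 1 - (0 + 0)"
  proof (intro tendsto_intros)
    show "(\<lambda>n. exp (- L n)) \<longlonglongrightarrow> 0"
      by (rule filterlim_compose[OF exp_at_bot])
        (use L_top in \<open>simp add: filterlim_uminus_at_bot\<close>)
    \<comment> \<open>The exponent is negative because
      \<open>\<tau> > 1 / (\<beta> - 1)\<close>.\<close>
    have "(\<lambda>n. real n powr (1 + \<tau> * (1 - \<beta>))) \<longlonglongrightarrow> 0"
      using \<tau> by (intro tendsto_neg_powr filterlim_real_sequentially)
    then have "(\<lambda>n. (1 / w0) powr (1 - \<beta>) * real n powr (1 + \<tau> * (1 - \<beta>))) \<longlonglongrightarrow> 0"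
      by (rule tendsto_mult_right_zero)
    moreover have "eventually (\<lambda>n. (1 / w0) powr (1 - \<beta>) * real n powr (1 + \<tau> * (1 - \<beta>))
        = real n * (t n / w0) powr (1 - \<beta>)) sequentially"
      using eventually_gt_at_top[of 0]
    proof eventually_elim
      case (elim n)
      have "(t n / w0) powr (1 - \<beta>) = t n powr (1 - \<beta>) * (1 / w0) powr (1 - \<beta>)"
        by (simp flip: powr_mult)
      then show ?case using elim by (simp add: t_def powr_powr powr_add)
    qed
    ultimately show "(\<lambda>n. real n * (t n / w0) powr (1 - \<beta>)) \<longlonglongrightarrow> 0"
      by (rule Lim_transform_eventually)
  qed
  have upper: "eventually (\<lambda>n. ?p n \<le> 1) sequentially"
    using assms by (intro always_eventually allI prob_space.prob_le_1 prob_space_girg_space) auto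
  have "?p \<longlonglongrightarrow> 1"
    by (rule tendsto_sandwich[OF lower upper _ tendsto_const]) (use lower_lim in simp)
  then show ?thesis using C unfolding L_def D_def by blast
qed

end
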